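(* (In $\mathrm{ZF}$.) For $n\in\{2,3\}$, $\mathrm{nRC_{fin}}$ implies $\mathrm{nC^-_{fin}}$.
   Context: The base theory is $\mathrm{ZF}$ (no Axiom of Choice). For a set $x$ and $n\in\omega$, $[x]^n$ is the set of all $n$-element subsets of $x$ and $[x]^{>n}$ is the set of all finite subsets of $x$ with more than $n$ elements. $\mathrm{nRC_{fin}}$: given any infinite set $x$, there exist an infinite subset $y\subseteq x$ and a function $f\colon[y]^{>n}\to[y]^n$ such that $f(z)\subseteq z$ for all $z\in[y]^{>n}$. $\mathrm{nC^-_{fin}}$: given any infinite family $\mathcal F$ of finite sets of cardinality greater than $n$, there exist an infinite subfamily $\mathcal A\subseteq\mathcal F$ and a function $f\colon\mathcal A\to[\bigcup\mathcal A]^n$ such that $f(A)\subseteq A$ for all $A\in\mathcal A$. *)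

theory Defs
  imports Main
begin

text \<open>
  HOL proves the Axiom of Choice, so the principles cannot be stated about HOL's own sets without
  becoming outright theorems. Claims ``in ZF'' are therefore stated for an arbitrary structure
  \<open>('a, mem)\<close> satisfying the first-order axioms of ZF. The two schemas range over the
  first-order formulas of the language of set theory; ranging over all HOL predicates would again
  make the Axiom of Choice hold in every model.
\<close>

text \<open>De Bruijn variables: \<open>All p\<close> binds index 0 of \<open>p\<close>.\<close>

datatype fm = Mem nat nat | Eq nat nat | Neg fm | Conj fm fm | All fm

locale set_structure =
  fixes mem :: "'a \<Rightarrow> 'a \<Rightarrow> bool" (infix "\<^bold>\<in>" 50)
begin

primrec sat :: "fm \<Rightarrow> (nat \<Rightarrow> 'a) \<Rightarrow> bool" where
  "sat (Mem i j) e \<longleftrightarrow> e i \<^bold>\<in> e j"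
| "sat (Eq i j) e \<longleftrightarrow> e i = e j"
| "sat (Neg p) e \<longleftrightarrow> \<not> sat p e"
| "sat (Conj p q) e \<longleftrightarrow> sat p e \<and> sat q e"
| "sat (All p) e \<longleftrightarrow> (\<forall>x. sat p (case_nat x e))"

text \<open>
  All notions below are internal: each is a first-order condition in \<open>mem\<close>, with quantifiers
  over the structure. In particular a ``finite'' set is one the structure believes finite, and
  functions are elements of the structure (sets of Kuratowski pairs).
\<close>

definition subset :: "'a \<Rightarrow> 'a \<Rightarrow> bool" (infix "\<^bold>\<subseteq>" 50) where
  "x \<^bold>\<subseteq> y \<longleftrightarrow> (\<forall>z. z \<^bold>\<in> x \<longrightarrow> z \<^bold>\<in> y)"

definition is_empty :: "'a \<Rightarrow> bool" where
  "is_empty x \<longleftrightarrow> (\<forall>z. \<not> z \<^bold>\<in> x)"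

definition is_upair :: "'a \<Rightarrow> 'a \<Rightarrow> 'a \<Rightarrow> bool" where
  "is_upair a b p \<longleftrightarrow> (\<forall>z. z \<^bold>\<in> p \<longleftrightarrow> z = a \<or> z = b)"

definition is_opair :: "'a \<Rightarrow> 'a \<Rightarrow> 'a \<Rightarrow> bool" where
  "is_opair a b p \<longleftrightarrow> (\<exists>u v. is_upair a a u \<and> is_upair a b v \<and> is_upair u v p)"

definition is_Union :: "'a \<Rightarrow> 'a \<Rightarrow> bool" where
  "is_Union x u \<longleftrightarrow> (\<forall>z. z \<^bold>\<in> u \<longleftrightarrow> (\<exists>y. y \<^bold>\<in> x \<and> z \<^bold>\<in> y))"

definition is_Pow :: "'a \<Rightarrow> 'a \<Rightarrow> bool" where
  "is_Pow x p \<longleftrightarrow> (\<forall>z. z \<^bold>\<in> p \<longleftrightarrow> z \<^bold>\<subseteq> x)"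

definition is_succ :: "'a \<Rightarrow> 'a \<Rightarrow> bool" where
  "is_succ x s \<longleftrightarrow> (\<forall>z. z \<^bold>\<in> s \<longleftrightarrow> z \<^bold>\<in> x \<or> z = x)"

definition is_inductive :: "'a \<Rightarrow> bool" where
  "is_inductive w \<longleftrightarrow>
     (\<exists>z. z \<^bold>\<in> w \<and> is_empty z) \<and> (\<forall>x. x \<^bold>\<in> w \<longrightarrow> (\<exists>s. s \<^bold>\<in> w \<and> is_succ x s))"

text \<open>Membership in \<open>\<omega>\<close>, the least inductive set.\<close>

definition is_nat :: "'a \<Rightarrow> bool" where
  "is_nat k \<longleftrightarrow> (\<forall>w. is_inductive w \<longrightarrow> k \<^bold>\<in> w)"

text \<open>\<open>n\<close> is the von Neumann numeral of the structure denoting the (standard) number \<open>k\<close>.\<close>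

primrec is_numeral :: "nat \<Rightarrow> 'a \<Rightarrow> bool" where
  "is_numeral 0 n \<longleftrightarrow> is_empty n"
| "is_numeral (Suc k) n \<longleftrightarrow> (\<exists>m. is_numeral k m \<and> is_succ m n)"

definition maps_to :: "'a \<Rightarrow> 'a \<Rightarrow> 'a \<Rightarrow> bool" where
  "maps_to f a b \<longleftrightarrow> (\<exists>p. p \<^bold>\<in> f \<and> is_opair a b p)"

definition is_function :: "'a \<Rightarrow> 'a \<Rightarrow> 'a \<Rightarrow> bool" where
  "is_function f x y \<longleftrightarrow>
     (\<forall>p. p \<^bold>\<in> f \<longrightarrow> (\<exists>a b. a \<^bold>\<in> x \<and> b \<^bold>\<in> y \<and> is_opair a b p)) \<and>
     (\<forall>a. a \<^bold>\<in> x \<longrightarrow> (\<exists>!b. maps_to f a b))"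

definition is_bijection :: "'a \<Rightarrow> 'a \<Rightarrow> 'a \<Rightarrow> bool" where
  "is_bijection f x y \<longleftrightarrow>
     is_function f x y \<and> (\<forall>b. b \<^bold>\<in> y \<longrightarrow> (\<exists>!a. maps_to f a b))"

definition equinumerous :: "'a \<Rightarrow> 'a \<Rightarrow> bool" where
  "equinumerous x y \<longleftrightarrow> (\<exists>f. is_bijection f x y)"

definition is_finite :: "'a \<Rightarrow> bool" where
  "is_finite x \<longleftrightarrow> (\<exists>k. is_nat k \<and> equinumerous x k)"

text \<open>For natural numbers, \<open>n < k\<close> is \<open>n \<^bold>\<in> k\<close>.\<close>

definition finite_card_gt :: "'a \<Rightarrow> 'a \<Rightarrow> bool" where
  "finite_card_gt n x \<longleftrightarrow> (\<exists>k. is_nat k \<and> n \<^bold>\<in> k \<and> equinumerous x k)"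

text \<open>\<open>p\<close> is $[x]^n$, respectively $[x]^{>n}$.\<close>

definition is_subsets_eq :: "'a \<Rightarrow> 'a \<Rightarrow> 'a \<Rightarrow> bool" where
  "is_subsets_eq n x p \<longleftrightarrow> (\<forall>z. z \<^bold>\<in> p \<longleftrightarrow> z \<^bold>\<subseteq> x \<and> equinumerous z n)"

definition is_subsets_gt :: "'a \<Rightarrow> 'a \<Rightarrow> 'a \<Rightarrow> bool" where
  "is_subsets_gt n x p \<longleftrightarrow> (\<forall>z. z \<^bold>\<in> p \<longleftrightarrow> z \<^bold>\<subseteq> x \<and> finite_card_gt n z)"

definition nRC_fin :: "'a \<Rightarrow> bool" where
  "nRC_fin n \<longleftrightarrow>
     (\<forall>x. \<not> is_finite x \<longrightarrow>
       (\<exists>y. y \<^bold>\<subseteq> x \<and> \<not> is_finite y \<and>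
         (\<exists>p q f. is_subsets_gt n y p \<and> is_subsets_eq n y q \<and> is_function f p q \<and>
           (\<forall>z v. z \<^bold>\<in> p \<longrightarrow> maps_to f z v \<longrightarrow> v \<^bold>\<subseteq> z))))"

definition nC_fin_minus :: "'a \<Rightarrow> bool" where
  "nC_fin_minus n \<longleftrightarrow>
     (\<forall>F. \<not> is_finite F \<and> (\<forall>x. x \<^bold>\<in> F \<longrightarrow> finite_card_gt n x) \<longrightarrow>
       (\<exists>A. A \<^bold>\<subseteq> F \<and> \<not> is_finite A \<and>
         (\<exists>u q f. is_Union A u \<and> is_subsets_eq n u q \<and> is_function f A q \<and>
           (\<forall>x v. x \<^bold>\<in> A \<longrightarrow> maps_to f x v \<longrightarrow> v \<^bold>\<subseteq> x))))"

end

text \<open>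
  In the schemas, \<open>e\<close> supplies the parameters. The formula sees the element of \<open>a\<close> as variable 0
  and, in replacement, its image as variable 1.
\<close>

locale ZF = set_structure +
  assumes extensionality: "\<forall>x y. (\<forall>z. z \<^bold>\<in> x \<longleftrightarrow> z \<^bold>\<in> y) \<longrightarrow> x = y"
    and foundation: "\<forall>x. (\<exists>y. y \<^bold>\<in> x) \<longrightarrow> (\<exists>y. y \<^bold>\<in> x \<and> (\<forall>z. z \<^bold>\<in> x \<longrightarrow> \<not> z \<^bold>\<in> y))"
    and pairing: "\<forall>a b. \<exists>p. is_upair a b p"
    and union: "\<forall>x. \<exists>u. is_Union x u"
    and power_set: "\<forall>x. \<exists>p. is_Pow x p"
    and infinity: "\<exists>w. is_inductive w"
    and separation:
      "\<forall>\<phi> e a. \<exists>b. \<forall>x. x \<^bold>\<in> b \<longleftrightarrow> x \<^bold>\<in> a \<and> sat \<phi> (case_nat x e)"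
    and replacement:
      "\<forall>\<phi> e a. (\<forall>x. x \<^bold>\<in> a \<longrightarrow> (\<exists>!y. sat \<phi> (case_nat x (case_nat y e)))) \<longrightarrow>
         (\<exists>b. \<forall>y. y \<^bold>\<in> b \<longleftrightarrow> (\<exists>x. x \<^bold>\<in> a \<and> sat \<phi> (case_nat x (case_nat y e))))"

end

(*
  Let k be 2 or 3 and let (A_i) be an infinite family of nonempty finite sets. Applying nRC_fin to
  the disjoint union of the A_i yields, on an infinite subfamily, a choice of a nonempty subset of
  A_i with a constant number of elements, at most k. If k = 3 and this number is 2, we may choose one
  element of each of these pairs, as follows. Nonempty traces of size 1 on infinitely many pairs
  are a choice already, so let the infinite set contain all pairs. A 3-subset of a finite union of
  pairs meets some pair in exactly one point; applied to two pairs this gives a tournament on the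
  index set. If no infinite subfamily had a choice of one point, in-degrees would be finite, and
  only finitely many indices could have the same in-degree m: otherwise take m + 1 of them and a
  further one beaten by all of these. If infinitely many indices share their in-degree with another
  one, apply the 3-subset function to the classes of equal in-degree; otherwise the in-degree well
  orders almost all indices, and i can be compared with the least j it beats. Either way infinitely
  many pairs get a point, a contradiction.
  So an infinite family of nonempty finite sets always has, on an infinite subfamily, a choice of
  one element or a choice of k elements. Iterating this on the complements of the elements chosen so
  far gives k elements.
*)

theory Submission
  imports Defs
begin

section \<open>Definability with parameters\<close>

primrec rename_fm :: "(nat \<Rightarrow> nat) \<Rightarrow> fm \<Rightarrow> fm" where
  "rename_fm r (Mem i j) = Mem (r i) (r j)"
| "rename_fm r (Eq i j) = Eq (r i) (r j)"
| "rename_fm r (Neg p) = Neg (rename_fm r p)"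
| "rename_fm r (Conj p q) = Conj (rename_fm r p) (rename_fm r q)"
| "rename_fm r (All p) = All (rename_fm (case_nat 0 (\<lambda>i. Suc (r i))) p)"

text \<open>Merging two whole environments avoids counting the variables or parameters that a
  formula uses: a list of parameters can itself be the interleaving of two others.\<close>

definition interleave :: "(nat \<Rightarrow> 'a) \<Rightarrow> (nat \<Rightarrow> 'a) \<Rightarrow> nat \<Rightarrow> 'a" where
  "interleave e p i = (if even i then e (i div 2) else p (i div 2))"

lemma interleave_simps [simp]: "interleave e p (2 * i) = e i" "interleave e p (Suc (2 * i)) = p i"
  by (simp_all add: interleave_def)

lemma even_odd_cases [case_names even odd]:
  obtains j where "i = 2 * j" | j where "i = Suc (2 * j)"
  by (metis evenE oddE Suc_eq_plus1)

named_theorems dfn_intros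

context set_structure
begin

lemma sat_rename_fm: "sat (rename_fm r p) e \<longleftrightarrow> sat p (\<lambda>i. e (r i))"
proof (induction p arbitrary: r e)
  case (All p)
  have "(\<lambda>i. case_nat x e (case_nat 0 (\<lambda>i. Suc (r i)) i)) = case_nat x (\<lambda>i. e (r i))" for x
    by (rule ext) (simp split: nat.split)
  then show ?case by (simp add: All)
qed auto

text \<open>
  Separation and replacement are available for these predicates only. Even variables of the
  formula read \<open>e\<close>, odd ones read the parameters \<open>p\<close>. Writing predicates as functions of an
  environment turns the substitution of de Bruijn variables into \<open>\<beta>\<close>-reduction, so that the rules
  \<open>dfn_intros\<close> decide definability syntactically.
\<close>

definition dfn :: "((nat \<Rightarrow> 'a) \<Rightarrow> bool) \<Rightarrow> bool" where
  "dfn P \<longleftrightarrow> (\<exists>\<phi> p. \<forall>e. P e \<longleftrightarrow> sat \<phi> (interleave e p))"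

text \<open>A term counts as definable if its graph is, with the value as variable 0. Inside a
  predicate it can then be eliminated by an existential quantifier, as in
  \<open>dfn_subst\<close>.\<close>

definition dft :: "((nat \<Rightarrow> 'a) \<Rightarrow> 'a) \<Rightarrow> bool" where
  "dft t \<longleftrightarrow> dfn (\<lambda>e. e 0 = t (\<lambda>i. e (Suc i)))"

lemma dfn_rename:
  assumes "dfn P"
  shows "dfn (\<lambda>e. P (\<lambda>i. e (r i)))"
proof -
  obtain \<phi> p where *: "\<And>e. P e \<longleftrightarrow> sat \<phi> (interleave e p)"
    using assms by (auto simp: dfn_def)
  let ?r = "\<lambda>i. if even i then 2 * r (i div 2) else i"
  have "(\<lambda>i. interleave e p (?r i)) = interleave (\<lambda>i. e (r i)) p" for e
    by (rule ext) (simp add: interleave_def)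
  then have "P (\<lambda>i. e (r i)) \<longleftrightarrow> sat (rename_fm ?r \<phi>) (interleave e p)" for e
    by (simp add: * sat_rename_fm)
  then show ?thesis unfolding dfn_def by blast
qed

section \<open>Closure of definable predicates under the logical operations\<close>

lemma dfn_not [dfn_intros]: "dfn P \<Longrightarrow> dfn (\<lambda>e. \<not> P e)"
  unfolding dfn_def by (metis sat.simps(3))

lemma dfn_conj [dfn_intros]:
  assumes "dfn P" "dfn Q"
  shows "dfn (\<lambda>e. P e \<and> Q e)"
proof -
  obtain \<phi> p where P: "\<And>e. P e \<longleftrightarrow> sat \<phi> (interleave e p)"
    using assms by (auto simp: dfn_def)
  obtain \<psi> q where Q: "\<And>e. Q e \<longleftrightarrow> sat \<psi> (interleave e q)"
    using assms by (auto simp: dfn_def)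
  \<comment> \<open>The parameters of the two formulas become the even and the odd entries of one
    list; \<open>?r\<close> and \<open>?s\<close> redirect the odd variables to them.\<close>
  let ?r = "\<lambda>i. if even i then i else Suc (2 * (2 * (i div 2)))"
  let ?s = "\<lambda>i. if even i then i else Suc (2 * Suc (2 * (i div 2)))"
  have "interleave e (interleave p q) (?r i) = interleave e p i" for e i
    using interleave_simps(2)[of e "interleave p q" "2 * (i div 2)"] interleave_simps(1)[of p q "i div 2"]
    by (cases i rule: even_odd_cases) simp_all
  moreover have "interleave e (interleave p q) (?s i) = interleave e q i" for e i
    using interleave_simps(2)[of e "interleave p q" "Suc (2 * (i div 2))"] interleave_simps(2)[of p q "i div 2"]
    by (cases i rule: even_odd_cases) simp_all
  ultimately have "P e \<and> Q e \<longleftrightarrow> sat (Conj (rename_fm ?r \<phi>) (rename_fm ?s \<psi>)) (interleave e (interleave p q))" for e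
    by (simp add: P Q sat_rename_fm)
  then show ?thesis unfolding dfn_def by blast
qed

lemma dfn_all [dfn_intros]:
  assumes "dfn (\<lambda>e. P (\<lambda>i. e (Suc i)) (e 0))"
  shows "dfn (\<lambda>e. \<forall>x. P e x)"
proof -
  obtain \<phi> p where *: "\<And>e. P (\<lambda>i. e (Suc i)) (e 0) \<longleftrightarrow> sat \<phi> (interleave e p)"
    using assms by (auto simp: dfn_def)
  \<comment> \<open>The quantifier of \<open>All\<close> shifts the whole interleaved environment by
    one, whereas adding \<open>x\<close> to \<open>e\<close> shifts only the even half.
    \<open>?r\<close> translates positions of the second kind into the first.\<close>
  let ?r = "\<lambda>i. if i = 0 then 0 else if even i then i - 1 else Suc i"
  have "case_nat x (interleave e p) (?r i) = interleave (case_nat x e) p i" for x e i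
  proof (cases i rule: even_odd_cases)
    case (even j)
    then show ?thesis
    proof (cases j)
      case (Suc l)
      then have "i = Suc (Suc (2 * l))" "case_nat x e j = e l" using even by simp_all
      then show ?thesis using interleave_simps(1)[of "case_nat x e" p j] even by simp
    qed (use interleave_simps(1)[of "case_nat x e" p 0] in simp)
  qed simp
  then have "(\<forall>x. P e x) \<longleftrightarrow> sat (All (rename_fm ?r \<phi>)) (interleave e p)" for e
    using *[of "case_nat _ e"] by (simp add: sat_rename_fm)
  then show ?thesis unfolding dfn_def by blast
qed

lemma dfn_cong: "dfn P \<Longrightarrow> (\<And>e. P e \<longleftrightarrow> Q e) \<Longrightarrow> dfn Q"
  by (simp add: dfn_def)

lemma dfn_const [dfn_intros]: "dfn (\<lambda>e. c)"
  unfolding dfn_def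
proof (cases c)
  case True
  have "\<forall>e. c \<longleftrightarrow> sat (Eq 0 0) (interleave e undefined)" using True by simp
  then show "\<exists>\<phi> p. \<forall>e. c \<longleftrightarrow> sat \<phi> (interleave e p)" by blast
next
  case False
  have "\<forall>e. c \<longleftrightarrow> sat (Neg (Eq 0 0)) (interleave e undefined)" using False by simp
  then show "\<exists>\<phi> p. \<forall>e. c \<longleftrightarrow> sat \<phi> (interleave e p)" by blast
qed

lemma dfn_ex [dfn_intros]:
  assumes "dfn (\<lambda>e. P (\<lambda>i. e (Suc i)) (e 0))"
  shows "dfn (\<lambda>e. \<exists>x. P e x)"
proof -
  have "dfn (\<lambda>e. \<not> (\<forall>x. \<not> P e x))"
    by (intro dfn_not dfn_all assms)
  then show ?thesis by simp
qed

lemma dfn_disj [dfn_intros]: "dfn P \<Longrightarrow> dfn Q \<Longrightarrow> dfn (\<lambda>e. P e \<or> Q e)"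
  using dfn_not[OF dfn_conj[OF dfn_not dfn_not], of P Q] by simp

lemma dfn_imp [dfn_intros]:
  assumes "dfn P" "dfn Q"
  shows "dfn (\<lambda>e. P e \<longrightarrow> Q e)"
proof -
  have "dfn (\<lambda>e. \<not> P e \<or> Q e)" by (rule dfn_disj[OF dfn_not[OF assms(1)] assms(2)])
  then show ?thesis by (rule dfn_cong) blast
qed

lemma dfn_iff [dfn_intros]:
  assumes "dfn P" "dfn Q"
  shows "dfn (\<lambda>e. P e \<longleftrightarrow> Q e)"
proof -
  have "dfn (\<lambda>e. (P e \<longrightarrow> Q e) \<and> (Q e \<longrightarrow> P e))"
    by (rule dfn_conj[OF dfn_imp[OF assms] dfn_imp[OF assms(2,1)]])
  then show ?thesis by (rule dfn_cong) blast
qed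

section \<open>Definable terms and substitution\<close>

lemma dft_var [dfn_intros]: "dft (\<lambda>e. e i)"
  unfolding dft_def dfn_def
  by (rule exI[of _ "Eq (2 * 0) (2 * Suc i)"], rule exI[of _ undefined],
      unfold sat.simps interleave_simps, intro allI refl)

lemma dft_const [dfn_intros]: "dft (\<lambda>e. c)"
  unfolding dft_def dfn_def
  by (rule exI[of _ "Eq (2 * 0) (Suc (2 * 0))"], rule exI[of _ "\<lambda>_. c"],
      unfold sat.simps interleave_simps, intro allI refl)

lemma dfn_subst:
  assumes t: "dft t" and P: "dfn (\<lambda>e. P (\<lambda>i. e (Suc i)) (e 0))"
  shows "dfn (\<lambda>e. P e (t e))"
proof -
  have "dfn (\<lambda>e. \<exists>x. x = t e \<and> P e x)"
    by (rule dfn_ex, rule dfn_conj[OF t[unfolded dft_def] P])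
  then show ?thesis by simp
qed

lemma dft_lift: "dft t \<Longrightarrow> dft (\<lambda>e. t (\<lambda>i. e (Suc i)))"
  unfolding dft_def by (drule dfn_rename[of _ "case_nat 0 (\<lambda>i. Suc (Suc i))"]) simp

text \<open>With these composition rules the definability of an internal relation is checked once,
  on bare variables, by unfolding its definition.\<close>

lemma dfn_app1:
  assumes "dfn (\<lambda>e. R (e 0))" "dft s"
  shows "dfn (\<lambda>e. R (s e))"
  by (rule dfn_subst[OF assms(2)]) (rule assms(1))

lemma dfn_app2:
  assumes R: "dfn (\<lambda>e. R (e 0) (e (Suc 0)))" and "dft s" "dft t"
  shows "dfn (\<lambda>e. R (s e) (t e))"
proof (rule dfn_subst[OF \<open>dft s\<close>])
  show "dfn (\<lambda>e. R (e 0) (t (\<lambda>i. e (Suc i))))"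
    by (rule dfn_subst[OF dft_lift[OF \<open>dft t\<close>]])
      (use dfn_rename[OF R, of "case_nat (Suc 0) (\<lambda>i. 0)"] in simp)
qed

lemma dfn_app3:
  assumes R: "dfn (\<lambda>e. R (e 0) (e (Suc 0)) (e (Suc (Suc 0))))" and "dft s" "dft t" "dft u"
  shows "dfn (\<lambda>e. R (s e) (t e) (u e))"
proof (rule dfn_subst[OF \<open>dft s\<close>])
  have "dfn (\<lambda>e. R (e (Suc 0)) (t (\<lambda>i. e (Suc (Suc i)))) (e 0))"
    by (rule dfn_subst[OF dft_lift[OF dft_lift[OF \<open>dft t\<close>]]])
      (use dfn_rename[OF R, of "case_nat (Suc (Suc 0)) (case_nat 0 (\<lambda>i. Suc 0))"] in simp)
  then show "dfn (\<lambda>e. R (e 0) (t (\<lambda>i. e (Suc i))) (u (\<lambda>i. e (Suc i))))"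
    by (rule dfn_subst[OF dft_lift[OF \<open>dft u\<close>]])
qed

lemma dfn_eq [dfn_intros]: "dft s \<Longrightarrow> dft t \<Longrightarrow> dfn (\<lambda>e. s e = t e)"
  by (rule dfn_app2[of "(=)"]) (use dft_var[of 0] in \<open>simp_all add: dft_def\<close>)

lemma dfn_mem [dfn_intros]: 
  assumes "dft s" "dft t" shows "dfn (\<lambda>e. s e \<^bold>\<in> t e)"
proof -
  have "dfn (\<lambda>e. e 0 \<^bold>\<in> e (Suc 0))"
    unfolding dfn_def
    by (rule exI[of _ "Mem (2 * 0) (2 * Suc 0)"], rule exI[of _ undefined],
        unfold sat.simps interleave_simps, intro allI refl)
  from dfn_app2[OF this assms] show ?thesis .
qed

text \<open>
  Unlike \<open>THE\<close>, this has the same junk value for all predicates, which makes it definable.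
\<close>

definition desc :: "('a \<Rightarrow> bool) \<Rightarrow> 'a" where
  "desc P = (if \<exists>!b. P b then THE b. P b else undefined)"

lemma descI: "\<exists>!b. P b \<Longrightarrow> P (desc P)"
  unfolding desc_def by (simp only: if_True theI')

lemma desc_eq:
  assumes "P a" "\<And>b. P b \<Longrightarrow> b = a"
  shows "desc P = a"
  by (rule assms(2), rule descI, rule ex1I[of P a], rule assms(1), rule assms(2))

lemma dft_desc [dfn_intros]:
  assumes "dfn (\<lambda>e. P (\<lambda>i. e (Suc i)) (e 0))"
  shows "dft (\<lambda>e. desc (P e))"
proof -
  define U where "U e \<longleftrightarrow> (\<exists>x. P e x \<and> (\<forall>y. P e y \<longrightarrow> y = x))" for e
  have "dfn (\<lambda>e. P (\<lambda>i. e (Suc (Suc i))) (e 0))"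
    using dfn_rename[OF assms, of "case_nat 0 (\<lambda>i. Suc (Suc i))"] by (simp only: nat.case)
  then have U: "dfn U"
    unfolding U_def by (intro dfn_ex dfn_all dfn_conj dfn_imp dfn_eq dft_var assms)
  have "dfn (\<lambda>e. U (\<lambda>i. e (Suc i)) \<and> P (\<lambda>i. e (Suc i)) (e 0)
    \<or> \<not> U (\<lambda>i. e (Suc i)) \<and> e 0 = undefined)"
    by (rule dfn_disj[OF dfn_conj[OF dfn_rename[OF U, of Suc] assms]
        dfn_conj[OF dfn_not[OF dfn_rename[OF U, of Suc]] dfn_eq[OF dft_var[of 0] dft_const[of undefined]]]])
  moreover have "(U e \<and> P e x \<or> \<not> U e \<and> x = undefined) \<longleftrightarrow> x = desc (P e)" for e x
  proof (cases "U e")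
    case True
    then have "\<exists>!b. P e b" by (auto simp: U_def)
    then have "P e x \<longleftrightarrow> x = desc (P e)" using descI[of "P e"] by blast
    with True show ?thesis by blast
  next
    case False
    then have "\<nexists>!b. P e b" by (auto simp: U_def)
    then have "desc (P e) = undefined" by (simp only: desc_def if_False)
    with False show ?thesis by (simp only: simp_thms)
  qed
  ultimately show ?thesis unfolding dft_def by (rule dfn_cong)
qed

lemma dft_app1:
  assumes "dft (\<lambda>e. h (e 0))" "dft s"
  shows "dft (\<lambda>e. h (s e))"
proof -
  have "dfn (\<lambda>e. e 0 = h (e (Suc 0)))"
    using assms(1) by (simp add: dft_def)
  from dfn_app2[of "\<lambda>x y. x = h y", OF this dft_var dft_lift[OF \<open>dft s\<close>]]
  show ?thesis by (simp add: dft_def)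
qed

lemma dft_if [dfn_intros]:
  assumes "dfn P" "dft s" "dft t"
  shows "dft (\<lambda>e. if P e then s e else t e)"
  unfolding dft_def
  by (rule dfn_cong[OF dfn_conj[OF dfn_imp[OF dfn_rename[OF \<open>dfn P\<close>, of Suc] \<open>dft s\<close>[unfolded dft_def]]
        dfn_imp[OF dfn_not[OF dfn_rename[OF \<open>dfn P\<close>, of Suc]] \<open>dft t\<close>[unfolded dft_def]]]]) auto

section \<open>Sets of the structure\<close>

text \<open>Extensions make HOL's set calculus available for members. Only the subsets of an
  extension that are definable with parameters come back as elements of the structure.\<close>

definition elts :: "'a \<Rightarrow> 'a set" where "elts x = {z. z \<^bold>\<in> x}"

lemma mem_iff_elts: "x \<^bold>\<in> y \<longleftrightarrow> x \<in> elts y"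
  by (simp add: elts_def)

lemma subset_iff_elts: "x \<^bold>\<subseteq> y \<longleftrightarrow> elts x \<subseteq> elts y"
  by (auto simp: subset_def elts_def)

lemma dfn_in_elts [dfn_intros]: "dft s \<Longrightarrow> dft t \<Longrightarrow> dfn (\<lambda>e. s e \<in> elts (t e))"
  by (simp add: elts_def dfn_mem)

lemma dfn_Ball [dfn_intros]:
  assumes "dft t" "dfn (\<lambda>e. P (\<lambda>i. e (Suc i)) (e 0))"
  shows "dfn (\<lambda>e. \<forall>x\<in>elts (t e). P e x)"
  unfolding Ball_def by (intro dfn_intros assms dft_lift[OF assms(1)])

lemma dfn_Bex [dfn_intros]:
  assumes "dft t" "dfn (\<lambda>e. P (\<lambda>i. e (Suc i)) (e 0))"
  shows "dfn (\<lambda>e. \<exists>x\<in>elts (t e). P e x)"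
  unfolding Bex_def by (intro dfn_intros assms dft_lift[OF assms(1)])

lemma dfn_subseteq [dfn_intros]: "dft s \<Longrightarrow> dft t \<Longrightarrow> dfn (\<lambda>e. elts (s e) \<subseteq> elts (t e))"
  by (rule dfn_app2[of "\<lambda>x y. elts x \<subseteq> elts y"]) (unfold subset_iff, intro dfn_intros)

lemma dfn_equinumerous [dfn_intros]: "dft s \<Longrightarrow> dft t \<Longrightarrow> dfn (\<lambda>e. equinumerous (s e) (t e))"
  by (rule dfn_app2[of equinumerous])
    (unfold equinumerous_def is_bijection_def is_function_def Ex1_def maps_to_def is_opair_def
      is_upair_def, intro dfn_intros)

lemma dfn_nat [dfn_intros]: "dft s \<Longrightarrow> dfn (\<lambda>e. is_nat (s e))"
  by (rule dfn_app1[of is_nat])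
    (unfold is_nat_def is_inductive_def is_empty_def is_succ_def, intro dfn_intros)

lemma dfn_finite [dfn_intros]: "dft s \<Longrightarrow> dfn (\<lambda>e. is_finite (s e))"
  by (rule dfn_app1[of is_finite]) (unfold is_finite_def, intro dfn_intros)

lemma dfn_finite_card_gt [dfn_intros]:
  "dft s \<Longrightarrow> dft t \<Longrightarrow> dfn (\<lambda>e. finite_card_gt (s e) (t e))"
  by (rule dfn_app2[of finite_card_gt]) (unfold finite_card_gt_def, intro dfn_intros)

section \<open>Set operations as definable terms\<close>

definition emptyset :: 'a where "emptyset = desc is_empty"
definition upair :: "'a \<Rightarrow> 'a \<Rightarrow> 'a" where "upair a b = desc (is_upair a b)"
definition opair :: "'a \<Rightarrow> 'a \<Rightarrow> 'a" where "opair a b = upair (upair a a) (upair a b)"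
definition big_cup :: "'a \<Rightarrow> 'a" where "big_cup x = desc (is_Union x)"
definition pow :: "'a \<Rightarrow> 'a" where "pow x = desc (is_Pow x)"
definition sep :: "'a \<Rightarrow> ('a \<Rightarrow> bool) \<Rightarrow> 'a" where
  "sep a P = desc (\<lambda>b. \<forall>x. x \<in> elts b \<longleftrightarrow> x \<in> elts a \<and> P x)"
definition repl :: "'a \<Rightarrow> ('a \<Rightarrow> 'a) \<Rightarrow> 'a" where
  "repl a h = desc (\<lambda>b. \<forall>y. y \<in> elts b \<longleftrightarrow> (\<exists>x\<in>elts a. y = h x))"
definition cup :: "'a \<Rightarrow> 'a \<Rightarrow> 'a" where "cup x y = big_cup (upair x y)"
definition ins :: "'a \<Rightarrow> 'a \<Rightarrow> 'a" where "ins a x = cup (upair a a) x"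
definition succ :: "'a \<Rightarrow> 'a" where "succ x = ins x x"
definition dif :: "'a \<Rightarrow> 'a \<Rightarrow> 'a" where "dif x y = sep x (\<lambda>z. z \<notin> elts y)"
definition cap :: "'a \<Rightarrow> 'a \<Rightarrow> 'a" where "cap x y = sep x (\<lambda>z. z \<in> elts y)"
definition rem :: "'a \<Rightarrow> 'a \<Rightarrow> 'a" where "rem x a = sep x (\<lambda>z. z \<noteq> a)"
definition proj1 :: "'a \<Rightarrow> 'a" where "proj1 p = desc (\<lambda>a. \<exists>b. p = opair a b)"
definition proj2 :: "'a \<Rightarrow> 'a" where "proj2 p = desc (\<lambda>b. \<exists>a. p = opair a b)"

lemma dft_app2:
  assumes h: "dft (\<lambda>e. h (e 0) (e (Suc 0)))" and "dft s" "dft t"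
  shows "dft (\<lambda>e. h (s e) (t e))"
proof -
  have "dfn (\<lambda>e. e 0 = h (e (Suc 0)) (e (Suc (Suc 0))))"
    using h by (simp add: dft_def)
  from dfn_app3[of "\<lambda>x y z. x = h y z", OF this dft_var dft_lift[OF \<open>dft s\<close>] dft_lift[OF \<open>dft t\<close>]]
  show ?thesis by (simp add: dft_def)
qed

lemma dft_upair [dfn_intros]: "dft s \<Longrightarrow> dft t \<Longrightarrow> dft (\<lambda>e. upair (s e) (t e))"
  by (rule dft_app2[of upair]) (unfold upair_def is_upair_def, intro dfn_intros)

lemma dft_opair [dfn_intros]: "dft s \<Longrightarrow> dft t \<Longrightarrow> dft (\<lambda>e. opair (s e) (t e))"
  by (unfold opair_def, intro dfn_intros)

lemma dft_big_cup [dfn_intros]: "dft s \<Longrightarrow> dft (\<lambda>e. big_cup (s e))"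
  by (rule dft_app1[of big_cup]) (unfold big_cup_def is_Union_def, intro dfn_intros)

lemma dft_cup [dfn_intros]: "dft s \<Longrightarrow> dft t \<Longrightarrow> dft (\<lambda>e. cup (s e) (t e))"
  by (unfold cup_def, intro dfn_intros)

lemma dft_ins [dfn_intros]: "dft s \<Longrightarrow> dft t \<Longrightarrow> dft (\<lambda>e. ins (s e) (t e))"
  by (unfold ins_def, intro dfn_intros)

lemma dft_succ [dfn_intros]: "dft s \<Longrightarrow> dft (\<lambda>e. succ (s e))"
  by (unfold succ_def, intro dfn_intros)

lemma dft_sep [dfn_intros]:
  assumes "dft t" "dfn (\<lambda>e. P (\<lambda>i. e (Suc i)) (e 0))"
  shows "dft (\<lambda>e. sep (t e) (P e))"
  unfolding sep_def
  by (intro dfn_intros dft_lift[OF dft_lift[OF assms(1)]])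
    (use dfn_rename[OF assms(2), of "case_nat 0 (\<lambda>i. Suc (Suc i))"] in simp)

lemma dft_repl [dfn_intros]:
  assumes "dft t" "dft (\<lambda>e. h (\<lambda>i. e (Suc i)) (e 0))"
  shows "dft (\<lambda>e. repl (t e) (h e))"
proof -
  have "dft (\<lambda>e. h (\<lambda>i. e (Suc (Suc (Suc i)))) (e 0))"
    using dfn_rename[OF assms(2)[unfolded dft_def], 
      of "case_nat 0 (case_nat (Suc 0) (\<lambda>i. Suc (Suc (Suc (Suc i)))))"] 
    by (simp add: dft_def)
  then show ?thesis
    unfolding repl_def by (intro dfn_intros dft_lift[OF dft_lift[OF assms(1)]])
qed

lemma dft_dif [dfn_intros]: "dft s \<Longrightarrow> dft t \<Longrightarrow> dft (\<lambda>e. dif (s e) (t e))"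
  by (rule dft_app2[of dif]) (unfold dif_def, intro dfn_intros)

lemma dft_cap [dfn_intros]: "dft s \<Longrightarrow> dft t \<Longrightarrow> dft (\<lambda>e. cap (s e) (t e))"
  by (rule dft_app2[of cap]) (unfold cap_def, intro dfn_intros)

lemma dft_proj1 [dfn_intros]: "dft s \<Longrightarrow> dft (\<lambda>e. proj1 (s e))"
  by (rule dft_app1[of proj1]) (unfold proj1_def, intro dfn_intros)

lemma dft_proj2 [dfn_intros]: "dft s \<Longrightarrow> dft (\<lambda>e. proj2 (s e))"
  by (rule dft_app1[of proj2]) (unfold proj2_def, intro dfn_intros)

end

text \<open>Class functions and classes of the structure, with parameters. They replace internal
  functions throughout; on a set the two are interchangeable.\<close>

abbreviation (in set_structure) dfun :: "('a \<Rightarrow> 'a) \<Rightarrow> bool" where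
  "dfun h \<equiv> dft (\<lambda>e. h (e 0))"

abbreviation (in set_structure) dpred :: "('a \<Rightarrow> bool) \<Rightarrow> bool" where
  "dpred P \<equiv> dfn (\<lambda>e. P (e 0))"

context ZF
begin

section \<open>The ZF axioms in terms of extensions\<close>

lemma elts_inject: "elts x = elts y \<longleftrightarrow> x = y"
  using extensionality by (auto simp: elts_def)

text \<open>Extensionality supplies uniqueness, so each operation defined by \<open>desc\<close>
  only needs existence, which is what the axioms give.\<close>

lemma elts_desc:
  assumes "\<exists>b. \<forall>z. z \<in> elts b \<longleftrightarrow> Q z"
  shows "elts (desc (\<lambda>b. \<forall>z. z \<in> elts b \<longleftrightarrow> Q z)) = {z. Q z}"
proof -
  have "\<exists>!b. \<forall>z. z \<in> elts b \<longleftrightarrow> Q z"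
  proof (rule ex_ex1I[OF assms])
    fix b c assume "\<forall>z. z \<in> elts b \<longleftrightarrow> Q z" "\<forall>z. z \<in> elts c \<longleftrightarrow> Q z"
    then have "elts b = elts c" by blast
    then show "b = c" by (simp only: elts_inject)
  qed
  from descI[OF this] show ?thesis by blast
qed

lemma elts_emptyset [simp]: "elts emptyset = {}"
proof -
  have "\<exists>b. \<forall>z. z \<in> elts b \<longleftrightarrow> False"
    using infinity by (auto simp: is_inductive_def is_empty_def elts_def)
  from elts_desc[OF this] show ?thesis by (simp add: emptyset_def is_empty_def[abs_def] mem_iff_elts)
qed

lemma elts_upair [simp]: "elts (upair a b) = {a, b}"
proof -
  have "\<exists>p. \<forall>z. z \<in> elts p \<longleftrightarrow> z = a \<or> z = b"
    using pairing by (simp add: is_upair_def mem_iff_elts)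
  from elts_desc[OF this] show ?thesis
    by (auto simp: upair_def is_upair_def[abs_def] mem_iff_elts)
qed

lemma elts_big_cup [simp]: "elts (big_cup x) = (\<Union>y\<in>elts x. elts y)"
proof -
  have "\<exists>u. \<forall>z. z \<in> elts u \<longleftrightarrow> (\<exists>y. y \<in> elts x \<and> z \<in> elts y)"
    using union by (simp add: is_Union_def mem_iff_elts)
  from elts_desc[OF this] show ?thesis
    by (auto simp: big_cup_def is_Union_def[abs_def] mem_iff_elts)
qed

lemma elts_pow [simp]: "elts (pow x) = {z. elts z \<subseteq> elts x}"
proof -
  have "\<exists>p. \<forall>z. z \<in> elts p \<longleftrightarrow> elts z \<subseteq> elts x"
    using power_set by (simp add: is_Pow_def mem_iff_elts subset_iff_elts)
  from elts_desc[OF this] show ?thesis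
    by (auto simp: pow_def is_Pow_def[abs_def] mem_iff_elts subset_iff_elts)
qed

lemma elts_sep:
  assumes "dpred P"
  shows "elts (sep a P) = {z \<in> elts a. P z}"
proof -
  obtain \<phi> p where "\<And>e. P (e 0) \<longleftrightarrow> sat \<phi> (interleave e p)"
    using assms by (auto simp: dfn_def)
  then have 1: "P x \<longleftrightarrow> sat \<phi> (interleave (\<lambda>_. x) p)" for x .
  \<comment> \<open>\<open>P\<close> looks at \<open>e 0\<close> only, so the environment may be
    taken constantly \<open>x\<close>. All even variables then collapse to variable 0, and the
    parameters follow it.\<close>
  let ?r = "\<lambda>i. if even i then 0 else Suc (i div 2)"
  have "case_nat x p (?r i) = interleave (\<lambda>_. x) p i" for x i
    by (simp add: interleave_def)
  then have "P x \<longleftrightarrow> sat (rename_fm ?r \<phi>) (case_nat x p)" for x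
    by (simp add: 1 sat_rename_fm)
  then have "\<exists>b. \<forall>z. z \<in> elts b \<longleftrightarrow> z \<in> elts a \<and> P z"
    using separation by (simp add: mem_iff_elts)
  from elts_desc[OF this] show ?thesis by (simp add: sep_def)
qed

lemma elts_repl:
  assumes "dfun h"
  shows "elts (repl a h) = h ` elts a"
proof -
  obtain \<phi> p where "\<And>e. e 0 = h (e (Suc 0)) \<longleftrightarrow> sat \<phi> (interleave e p)"
    using assms by (auto simp: dfn_def dft_def)
  from this[of "case_nat _ (\<lambda>_. _)"]
  have 1: "y = h x \<longleftrightarrow> sat \<phi> (interleave (case_nat y (\<lambda>_. x)) p)" for x y by simp
  \<comment> \<open>A graph in the sense of \<open>dft\<close> has the value at variable 0 and the
    argument after it; replacement has them the other way round, hence the swap.\<close>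
  let ?r = "\<lambda>i. if i = 0 then Suc 0 else if even i then 0 else Suc (Suc (i div 2))"
  have "(\<lambda>i. case_nat x (case_nat y p) (?r i)) = interleave (case_nat y (\<lambda>_. x)) p" for x y
    by (rule ext) (auto simp: interleave_def split: nat.split)
  then have 2: "y = h x \<longleftrightarrow> sat (rename_fm ?r \<phi>) (case_nat x (case_nat y p))" for x y
    by (simp only: sat_rename_fm 1[symmetric])
  have "\<exists>b. \<forall>y. y \<^bold>\<in> b \<longleftrightarrow> (\<exists>x. x \<^bold>\<in> a \<and> sat (rename_fm ?r \<phi>) (case_nat x (case_nat y p)))"
    by (rule replacement[THEN spec, of "rename_fm ?r \<phi>", THEN spec, of p, THEN spec, of a, THEN mp])
      (unfold 2[symmetric], intro allI impI ex1I, rule refl, assumption)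
  then obtain b where "\<forall>y. y \<^bold>\<in> b \<longleftrightarrow> (\<exists>x. x \<^bold>\<in> a \<and> sat (rename_fm ?r \<phi>) (case_nat x (case_nat y p)))" ..
  then have "\<forall>y. y \<^bold>\<in> b \<longleftrightarrow> (\<exists>x. x \<^bold>\<in> a \<and> y = h x)"
    unfolding 2[symmetric] .
  then have "\<forall>y. y \<in> elts b \<longleftrightarrow> (\<exists>x\<in>elts a. y = h x)"
    by (auto simp: mem_iff_elts)
  then have "\<exists>b. \<forall>y. y \<in> elts b \<longleftrightarrow> (\<exists>x\<in>elts a. y = h x)" by (rule exI)
  from elts_desc[OF this] show ?thesis by (auto simp: repl_def)
qed

lemma elts_cup [simp]: "elts (cup x y) = elts x \<union> elts y"
  by (simp add: cup_def)

lemma elts_ins [simp]: "elts (ins a x) = insert a (elts x)"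
  by (simp add: ins_def)

lemma elts_succ [simp]: "elts (succ x) = insert x (elts x)"
  by (simp add: succ_def)

lemma elts_dif [simp]: "elts (dif x y) = elts x - elts y"
  unfolding dif_def by (subst elts_sep, intro dfn_intros) auto

lemma elts_cap [simp]: "elts (cap x y) = elts x \<inter> elts y"
  unfolding cap_def by (subst elts_sep, intro dfn_intros) auto

lemma elts_rem [simp]: "elts (rem x a) = elts x - {a}"
  unfolding rem_def by (subst elts_sep, intro dfn_intros) auto

lemma is_upair_iff: "is_upair a b p \<longleftrightarrow> p = upair a b"
proof -
  have "is_upair a b p \<longleftrightarrow> elts p = elts (upair a b)" by (auto simp: is_upair_def mem_iff_elts)
  then show ?thesis by (simp only: elts_inject)
qed

lemma is_opair_iff: "is_opair a b p \<longleftrightarrow> p = opair a b"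
  by (auto simp: is_opair_def is_upair_iff opair_def)

lemma upair_eq_iff: "upair a b = upair c d \<longleftrightarrow> a = c \<and> b = d \<or> a = d \<and> b = c"
  by (simp only: elts_inject[symmetric] elts_upair doubleton_eq_iff)

lemma opair_eq_iff [simp]: "opair a b = opair c d \<longleftrightarrow> a = c \<and> b = d"
  by (auto simp: opair_def upair_eq_iff)

lemma proj1_opair [simp]: "proj1 (opair a b) = a"
  unfolding proj1_def by (rule desc_eq) auto

lemma proj2_opair [simp]: "proj2 (opair a b) = b"
  unfolding proj2_def by (rule desc_eq) auto

lemma maps_to_iff: "maps_to f a b \<longleftrightarrow> opair a b \<in> elts f"
  by (simp add: maps_to_def is_opair_iff mem_iff_elts)

lemma is_function_iff:
  "is_function f x y \<longleftrightarrow> (\<forall>p\<in>elts f. \<exists>a\<in>elts x. \<exists>b\<in>elts y. p = opair a b) \<and> (\<forall>a\<in>elts x. \<exists>!b. opair a b \<in> elts f)"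
  by (simp only: is_function_def maps_to_iff is_opair_iff mem_iff_elts) blast

section \<open>Internal functions, class functions and equinumerosity\<close>

lemma function_of_dfun:
  assumes "dfun h" "h ` elts x \<subseteq> elts y"
  shows "\<exists>f. is_function f x y \<and> (\<forall>a b. maps_to f a b \<longleftrightarrow> a \<in> elts x \<and> b = h a)"
proof (intro exI conjI allI)
  let ?f = "repl x (\<lambda>a. opair a (h a))"
  have f: "elts ?f = (\<lambda>a. opair a (h a)) ` elts x"
    by (rule elts_repl) (intro dfn_intros assms)
  show "maps_to ?f a b \<longleftrightarrow> a \<in> elts x \<and> b = h a" for a b
    by (auto simp: maps_to_iff f)
  show "is_function ?f x y"
    using assms(2) unfolding is_function_iff f by auto
qed

lemma dfun_of_function:
  assumes "is_function f x y"
  shows "\<exists>h. dfun h \<and> (\<forall>a\<in>elts x. h a \<in> elts y) \<and> (\<forall>a b. maps_to f a b \<longleftrightarrow> a \<in> elts x \<and> b = h a)"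
proof (intro exI conjI allI ballI)
  let ?h = "\<lambda>a. desc (\<lambda>b. opair a b \<in> elts f)"
  show "dfun ?h" by (intro dfn_intros)
  have *: "opair a (?h a) \<in> elts f" if "a \<in> elts x" for a
    by (rule descI[of "\<lambda>b. opair a b \<in> elts f"]) (use assms that in \<open>simp add: is_function_iff\<close>)
  then show "?h a \<in> elts y" if "a \<in> elts x" for a
    using assms that opair_eq_iff unfolding is_function_iff by metis
  show "maps_to f a b \<longleftrightarrow> a \<in> elts x \<and> b = ?h a" for a b
    using assms * opair_eq_iff unfolding is_function_iff maps_to_iff by metis
qed

text \<open>From here on bijections are HOL bijections between extensions, with definability as the
  only additional obligation.\<close>

lemma equinumerous_iff: "equinumerous x y \<longleftrightarrow> (\<exists>h. dfun h \<and> bij_betw h (elts x) (elts y))"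
proof
  assume "equinumerous x y"
  then obtain f where f: "is_function f x y" and b: "\<And>b. b \<in> elts y \<Longrightarrow> \<exists>!a. maps_to f a b"
    by (auto simp: equinumerous_def is_bijection_def mem_iff_elts)
  obtain h where h: "dfun h" "\<And>a. a \<in> elts x \<Longrightarrow> h a \<in> elts y"
    "\<And>a b. maps_to f a b \<longleftrightarrow> a \<in> elts x \<and> b = h a"
    using dfun_of_function[OF f] by auto
  have "bij_betw h (elts x) (elts y)"
    using b h(2) unfolding h(3) by (intro bij_betwI') metis+
  with h(1) show "\<exists>h. dfun h \<and> bij_betw h (elts x) (elts y)" by blast
next
  assume "\<exists>h. dfun h \<and> bij_betw h (elts x) (elts y)"
  then obtain h where h: "dfun h" "bij_betw h (elts x) (elts y)" by blast
  then have hi: "h ` elts x = elts y" and inj: "inj_on h (elts x)" by (auto simp: bij_betw_def)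
  obtain f where f: "is_function f x y" "\<And>a b. maps_to f a b \<longleftrightarrow> a \<in> elts x \<and> b = h a"
    using function_of_dfun[OF h(1) equalityD1[OF hi]] by auto
  have "\<exists>!a. maps_to f a b" if "b \<in> elts y" for b
    using that inj unfolding f(2) hi[symmetric] inj_on_def by blast
  with f(1) show "equinumerous x y"
    by (auto simp only: equinumerous_def is_bijection_def mem_iff_elts)
qed

lemma equinumerousI: "dfun h \<Longrightarrow> bij_betw h (elts x) (elts y) \<Longrightarrow> equinumerous x y"
  unfolding equinumerous_iff by (intro exI conjI)

lemma equinumerous_trans:
  assumes "equinumerous x y" "equinumerous y z"
  shows "equinumerous x z"
proof -
  obtain g h where "dfun g" "bij_betw g (elts x) (elts y)" "dfun h" "bij_betw h (elts y) (elts z)"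
    using assms unfolding equinumerous_iff by blast
  then have "dfun (\<lambda>a. h (g a))" "bij_betw (\<lambda>a. h (g a)) (elts x) (elts z)"
    using bij_betw_trans[of g "elts x" "elts y" h "elts z"] by (auto simp: o_def intro: dft_app1[of h])
  then show ?thesis by (rule equinumerousI)
qed

lemma equinumerous_sym:
  assumes "equinumerous x y"
  shows "equinumerous y x"
proof -
  obtain h where h: "dfun h" "bij_betw h (elts x) (elts y)"
    using assms unfolding equinumerous_iff by blast
  \<comment> \<open>\<open>inv_into\<close> rests on HOL's choice operator and has no definability
    rule. The description is definable and agrees with it on \<open>elts y\<close>.\<close>
  let ?g = "\<lambda>b. desc (\<lambda>a. a \<in> elts x \<and> h a = b)"
  have "?g b = inv_into (elts x) h b" if "b \<in> elts y" for b
    using that h(2) by (intro desc_eq) (auto simp: bij_betw_def f_inv_into_f inv_into_into)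
  then have "bij_betw ?g (elts y) (elts x)"
    using bij_betw_inv_into[OF h(2)] bij_betw_cong[of "elts y" ?g "inv_into (elts x) h"] by blast
  moreover have "dfun ?g"
    by (intro dfn_intros dft_app1[OF h(1)])
  ultimately show ?thesis by (intro equinumerousI)
qed

lemma equinumerous_refl: "equinumerous x x"
  by (rule equinumerousI[OF dft_var]) (simp add: bij_betw_def)

lemma equinumerous_ins:
  assumes "equinumerous x y" "a \<notin> elts x" "b \<notin> elts y"
  shows "equinumerous (ins a x) (ins b y)"
proof -
  obtain h where h: "dfun h" "bij_betw h (elts x) (elts y)"
    using assms unfolding equinumerous_iff by blast
  let ?g = "\<lambda>z. if z = a then b else h z"
  have "?g z = h z" if "z \<in> elts x" for z
    using that assms(2) by auto
  then have "bij_betw ?g (elts x) (elts y)"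
    using h(2) bij_betw_cong[of "elts x" ?g h "elts y"] by blast
  then have "bij_betw ?g (insert a (elts x)) (insert b (elts y))"
    using assms(2,3) bij_betw_combine[of ?g "{a}" "{b}" "elts x" "elts y"] by (auto simp: bij_betw_def)
  moreover have "dfun ?g"
    by (intro dfn_intros dft_app1[OF h(1)])
  ultimately show ?thesis by (intro equinumerousI) simp_all
qed

lemma equinumerous_rem:
  assumes "equinumerous x y" "a \<in> elts x" "b \<in> elts y"
  shows "equinumerous (rem x a) (rem y b)"
proof -
  obtain h where h: "dfun h" "bij_betw h (elts x) (elts y)"
    using assms unfolding equinumerous_iff by blast
  \<comment> \<open>Removing \<open>b\<close> leaves its preimage without an image, unless that
    preimage is \<open>a\<close>; the value \<open>h a\<close>, now free, takes its place.\<close>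
  let ?g = "\<lambda>z. if h z = b then h a else h z"
  have inj: "z = w" if "z \<in> elts x" "w \<in> elts x" "h z = h w" for z w
    using h(2) that by (auto simp: bij_betw_def dest: inj_onD)
  have hi: "h ` elts x = elts y" using h(2) by (simp add: bij_betw_def)
  have "bij_betw ?g (elts x - {a}) (elts y - {b})"
  proof (rule bij_betwI')
    fix z w assume "z \<in> elts x - {a}" "w \<in> elts x - {a}"
    then show "?g z = ?g w \<longleftrightarrow> z = w"
      using inj[of z w] inj[of z a] inj[of w a] assms(2) by auto
  next
    fix z assume "z \<in> elts x - {a}"
    then show "?g z \<in> elts y - {b}"
      using inj[of z a] assms(2) hi by auto
  next
    fix v assume v: "v \<in> elts y - {b}"
    then have "v \<in> h ` elts x" "b \<in> h ` elts x" using hi assms(3) by simp_all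
    then obtain z c where z: "z \<in> elts x" "h z = v" and c: "c \<in> elts x" "h c = b" by blast
    show "\<exists>z\<in>elts x - {a}. v = ?g z"
    proof (cases "z = a")
      case True
      then show ?thesis using z c v by (intro bexI[of _ c]) auto
    next
      case False
      then show ?thesis using z v by (intro bexI[of _ z]) auto
    qed
  qed
  moreover have "dfun ?g"
    by (intro dfn_intros dft_app1[OF h(1)])
  ultimately show ?thesis by (intro equinumerousI) simp_all
qed

section \<open>Natural numbers and finite sets of the structure\<close>

lemma is_succ_iff: "is_succ x s \<longleftrightarrow> s = succ x"
proof -
  have "is_succ x s \<longleftrightarrow> elts s = elts (succ x)" by (auto simp: is_succ_def mem_iff_elts)
  then show ?thesis by (simp only: elts_inject)
qed

lemma is_empty_iff: "is_empty x \<longleftrightarrow> x = emptyset"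
proof -
  have "is_empty x \<longleftrightarrow> elts x = elts emptyset" by (auto simp: is_empty_def mem_iff_elts)
  then show ?thesis by (simp only: elts_inject)
qed

lemma is_inductive_iff: "is_inductive w \<longleftrightarrow> emptyset \<in> elts w \<and> (\<forall>x\<in>elts w. succ x \<in> elts w)"
  by (auto simp: is_inductive_def is_empty_iff is_succ_iff mem_iff_elts)

lemma is_nat_emptyset: "is_nat emptyset"
  by (simp add: is_nat_def is_inductive_iff mem_iff_elts)

lemma is_nat_succ: "is_nat k \<Longrightarrow> is_nat (succ k)"
  by (simp add: is_nat_def is_inductive_iff mem_iff_elts)

text \<open>Separation cuts the good elements out of an inductive set, which leaves an inductive
  set. Elements satisfying \<open>is_nat\<close> may be nonstandard, so definability is a genuine
  proof obligation, the case \<open>dpred\<close>.\<close>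

lemma is_nat_induct [consumes 1, case_names dpred emptyset succ]:
  assumes "is_nat k" and P: "dpred P" and "P emptyset" "\<And>k. is_nat k \<Longrightarrow> P k \<Longrightarrow> P (succ k)"
  shows "P k"
proof -
  obtain w where w: "is_inductive w" using infinity by blast
  let ?w = "sep w (\<lambda>k. is_nat k \<and> P k)"
  have elts: "elts ?w = {k \<in> elts w. is_nat k \<and> P k}"
    by (rule elts_sep) (intro dfn_intros P)
  have "is_inductive ?w"
    using w assms(3,4) is_nat_emptyset is_nat_succ by (auto simp: is_inductive_iff elts)
  then have "k \<in> elts ?w" using assms(1) by (auto simp: is_nat_def mem_iff_elts)
  then show ?thesis by (simp add: elts)
qed

lemma not_mem_self: "x \<notin> elts x"
proof
  assume "x \<in> elts x"
  have "\<exists>y. y \<in> elts (upair x x) \<and> (\<forall>z. z \<in> elts (upair x x) \<longrightarrow> z \<notin> elts y)"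
    by (rule foundation[simplified mem_iff_elts, THEN spec, THEN mp]) auto
  with \<open>x \<in> elts x\<close> show False by auto
qed

lemma is_nat_transitive:
  assumes "is_nat k" "m \<in> elts k"
  shows "is_nat m \<and> elts m \<subseteq> elts k"
proof -
  have "\<forall>m\<in>elts k. is_nat m \<and> elts m \<subseteq> elts k"
    using assms(1)
  proof (induction rule: is_nat_induct)
    case dpred
    show ?case by (intro dfn_intros)
  qed auto
  with assms(2) show ?thesis by blast
qed

lemma is_nat_trichotomy:
  assumes "is_nat m" "is_nat k"
  shows "m \<in> elts k \<or> m = k \<or> k \<in> elts m"
proof -
  have emptyset: "m = emptyset \<or> emptyset \<in> elts m" if "is_nat m" for m
    using that
  proof (induction rule: is_nat_induct)
    case dpred
    show ?case by (intro dfn_intros)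
  qed auto
  have succ: "\<forall>k\<in>elts m. succ k \<in> elts m \<or> succ k = m" if "is_nat m" for m
    using that
  proof (induction rule: is_nat_induct)
    case dpred
    show ?case by (intro dfn_intros)
  qed auto
  have "\<forall>m. is_nat m \<longrightarrow> m \<in> elts k \<or> m = k \<or> k \<in> elts m"
    using assms(2)
  proof (induction rule: is_nat_induct)
    case dpred
    show ?case by (intro dfn_intros)
  next
    case (succ k)
    then show ?case using \<open>\<And>m. is_nat m \<Longrightarrow> \<forall>k\<in>elts m. succ k \<in> elts m \<or> succ k = m\<close> by auto
  qed (use emptyset in auto)
  with assms(1) show ?thesis by blast
qed

lemma equinumerous_emptyset_iff: "equinumerous x emptyset \<longleftrightarrow> elts x = {}"
proof
  assume "equinumerous x emptyset"
  then show "elts x = {}" by (auto simp: equinumerous_iff bij_betw_def)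
next
  assume "elts x = {}"
  then have "x = emptyset" using elts_inject[of x emptyset] by simp
  then show "equinumerous x emptyset" by (simp add: equinumerous_refl)
qed

lemma equinumerous_succ_elim:
  assumes "equinumerous x (succ k)"
  obtains a where "a \<in> elts x" "equinumerous (rem x a) k"
proof -
  obtain h where "bij_betw h (elts x) (insert k (elts k))"
    using assms by (auto simp: equinumerous_iff)
  then have "h ` elts x = insert k (elts k)" by (simp add: bij_betw_def)
  then obtain a where a: "a \<in> elts x" by auto
  have "elts (rem (succ k) k) = elts k" using not_mem_self[of k] by auto
  then have "rem (succ k) k = k" by (simp only: elts_inject)
  then show ?thesis using equinumerous_rem[OF assms a, of k] a that by auto
qed

lemma equinumerous_succ: "equinumerous u k \<Longrightarrow> a \<notin> elts u \<Longrightarrow> equinumerous (ins a u) (succ k)"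
  unfolding succ_def by (rule equinumerous_ins) (auto simp: not_mem_self)

lemma ins_rem: "a \<in> elts x \<Longrightarrow> ins a (rem x a) = x"
proof -
  assume "a \<in> elts x"
  then have "elts (ins a (rem x a)) = elts x" by auto
  then show ?thesis by (simp only: elts_inject)
qed

section \<open>Internally finite sets\<close>

lemma is_finite_emptyset: "is_finite emptyset"
  unfolding is_finite_def using is_nat_emptyset equinumerous_refl by blast

lemma is_finite_ins: "is_finite u \<Longrightarrow> is_finite (ins a u)"
proof -
  assume u: "is_finite u"
  show ?thesis
  proof (cases "a \<in> elts u")
    case True
    then have "elts (ins a u) = elts u" by auto
    then have "ins a u = u" by (simp only: elts_inject)
    with u show ?thesis by simp
  next
    case False
    then show ?thesis using u equinumerous_succ is_nat_succ unfolding is_finite_def by blast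
  qed
qed

text \<open>Induction on the internal cardinality. Again only definable predicates qualify, since an
  internally finite set may be infinite in HOL.\<close>

lemma is_finite_induct [consumes 1, case_names dpred emptyset ins]:
  assumes "is_finite x" and P: "dpred P" and "P emptyset"
    and ins: "\<And>u a. is_finite u \<Longrightarrow> a \<notin> elts u \<Longrightarrow> P u \<Longrightarrow> P (ins a u)"
  shows "P x"
proof -
  obtain k where k: "is_nat k" "equinumerous x k"
    using assms(1) by (auto simp: is_finite_def)
  have "\<forall>x. equinumerous x k \<longrightarrow> P x"
    using k(1)
  proof (induction rule: is_nat_induct)
    case dpred
    show ?case by (intro dfn_intros dfn_app1[OF P])
  next
    case emptyset
    show ?case using \<open>P emptyset\<close> elts_inject[of _ emptyset] by (auto simp: equinumerous_emptyset_iff)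
  next
    case (succ k)
    show ?case
    proof (intro allI impI)
      fix x assume "equinumerous x (succ k)"
      then obtain a where a: "a \<in> elts x" "equinumerous (rem x a) k"
        by (rule equinumerous_succ_elim)
      then have "P (ins a (rem x a))"
        using succ by (intro ins) (auto simp: is_finite_def)
      then show "P x" by (simp add: ins_rem a)
    qed
  qed
  with k(2) show ?thesis by blast
qed

lemma is_finite_subset:
  assumes "is_finite x" "elts y \<subseteq> elts x"
  shows "is_finite y"
proof -
  have "\<forall>y. elts y \<subseteq> elts x \<longrightarrow> is_finite y"
    using assms(1)
  proof (induction rule: is_finite_induct)
    case dpred
    show ?case by (intro dfn_intros)
  next
    case emptyset
    show ?case using is_finite_emptyset elts_inject[of _ emptyset] by auto
  next
    case (ins u a)
    show ?case
    proof (intro allI impI)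
      fix y assume y: "elts y \<subseteq> elts (ins a u)"
      then have "elts (rem y a) \<subseteq> elts u" by auto
      then have "is_finite (rem y a)" using ins by blast
      moreover have "elts y \<subseteq> elts u \<or> ins a (rem y a) = y"
        using y ins_rem[of a y] by auto
      ultimately show "is_finite y" using is_finite_ins[of "rem y a" a] ins by auto
    qed
  qed
  with assms(2) show ?thesis by blast
qed

lemma is_finite_cup: "is_finite x \<Longrightarrow> is_finite y \<Longrightarrow> is_finite (cup x y)"
proof (induction rule: is_finite_induct)
  case dpred
  show ?case by (intro dfn_intros)
next
  case emptyset
  then show ?case by (auto intro: is_finite_subset)
next
  case (ins u a)
  then have "is_finite (ins a (cup u y))" by (intro is_finite_ins) 
  then show ?case by (rule is_finite_subset) auto
qed

lemma is_finite_repl: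
  assumes "dfun h" "is_finite x"
  shows "is_finite (repl x h)"
  using assms(2)
proof (induction rule: is_finite_induct)
  case dpred
  show ?case by (intro dfn_intros dft_app1[OF assms(1)])
next
  case emptyset
  show ?case by (rule is_finite_subset[OF is_finite_emptyset]) (simp add: elts_repl assms(1))
next
  case (ins u a)
  then have "is_finite (ins (h a) (repl u h))" by (intro is_finite_ins)
  then show ?case by (rule is_finite_subset) (simp add: elts_repl assms(1))
qed

lemma is_finite_big_cup:
  assumes "is_finite x" "\<forall>y\<in>elts x. is_finite y"
  shows "is_finite (big_cup x)"
proof -
  have "(\<forall>y\<in>elts x. is_finite y) \<longrightarrow> is_finite (big_cup x)"
    using assms(1)
  proof (induction rule: is_finite_induct)
    case dpred
    show ?case by (intro dfn_intros)
  next
    case emptyset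
    show ?case by (auto intro: is_finite_subset[OF is_finite_emptyset])
  next
    case (ins u a)
    show ?case
    proof
      assume "\<forall>y\<in>elts (ins a u). is_finite y"
      with ins have "is_finite (cup a (big_cup u))" by (intro is_finite_cup) auto
      then show "is_finite (big_cup (ins a u))" by (rule is_finite_subset) auto
    qed
  qed
  with assms(2) show ?thesis by blast
qed

lemma is_finite_UN:
  assumes "dfun h" "is_finite x" "\<And>i. i \<in> elts x \<Longrightarrow> is_finite (h i)" 
    and "elts y \<subseteq> (\<Union>i\<in>elts x. elts (h i))"
  shows "is_finite y"
proof (rule is_finite_subset)
  show "is_finite (big_cup (repl x h))"
    using assms by (intro is_finite_big_cup is_finite_repl) (auto simp: elts_repl)
qed (use assms in \<open>simp add: elts_repl\<close>)

text \<open>Internal induction on \<open>k\<close>, deleting a common element from both sets. This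
  covers nonstandard sizes, which in-degrees may have later.\<close>

lemma is_nat_pigeonhole:
  assumes "is_nat k" "equinumerous x k" "equinumerous s (succ k)" "elts s \<subseteq> elts x"
  shows False
proof -
  have "\<forall>x s. equinumerous x k \<and> equinumerous s (succ k) \<longrightarrow> \<not> elts s \<subseteq> elts x"
    using assms(1)
  proof (induction rule: is_nat_induct)
    case dpred
    show ?case by (intro dfn_intros)
  next
    case emptyset
    show ?case by (auto simp: equinumerous_emptyset_iff elim!: equinumerous_succ_elim)
  next
    case (succ k)
    show ?case
    proof (intro allI impI notI)
      fix x s assume *: "equinumerous x (succ k) \<and> equinumerous s (succ (succ k))" "elts s \<subseteq> elts x"
      then obtain a where a: "a \<in> elts s" "equinumerous (rem s a) (succ k)"
        using equinumerous_succ_elim by blast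
      have "elts (rem (succ k) k) = elts k" using not_mem_self[of k] by auto
      then have "rem (succ k) k = k" by (simp only: elts_inject)
      then have "equinumerous (rem x a) k" 
        using equinumerous_rem[of x "succ k" a k] * a by auto
      moreover have "elts (rem s a) \<subseteq> elts (rem x a)" using * by auto
      ultimately show False using succ a by blast
    qed
  qed
  with assms show False by blast
qed

lemma is_nat_equinumerous_unique:
  assumes "is_nat k" "is_nat m" "equinumerous x k" "equinumerous x m"
  shows "k = m"
proof -
  have *: "m \<notin> elts k" if "is_nat k" "equinumerous x k" "equinumerous x m" for k m
  proof
    assume m: "m \<in> elts k"
    then have "is_nat m" "elts (succ m) \<subseteq> elts k" using is_nat_transitive that by auto
    moreover have "equinumerous k m" using that equinumerous_sym equinumerous_trans by blast
    ultimately show False using is_nat_pigeonhole[of m k "succ m"] equinumerous_refl by blast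
  qed
  show ?thesis using is_nat_trichotomy[OF assms(1,2)] *[OF assms(1,3,4)] *[OF assms(2,4,3)] by blast
qed

text \<open>The induction runs inside the structure because \<open>k\<close> may be nonstandard.
  Only existence is claimed for each size, so no sequence of choices is made.\<close>

lemma infinite_subset_of_size:
  assumes "is_nat k" "\<not> is_finite x"
  obtains s where "elts s \<subseteq> elts x" "equinumerous s k"
proof -
  have "\<exists>s. elts s \<subseteq> elts x \<and> equinumerous s k"
    using assms(1)
  proof (induction rule: is_nat_induct)
    case dpred
    show ?case by (intro dfn_intros)
  next
    case emptyset
    show ?case by (rule exI[of _ emptyset]) (simp add: equinumerous_refl)
  next
    case (succ k)
    then obtain s where s: "elts s \<subseteq> elts x" "equinumerous s k" by blast
    then have "is_finite s" using succ by (auto simp: is_finite_def)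
    then have "\<not> elts x \<subseteq> elts s" using assms(2) is_finite_subset by blast
    then obtain a where "a \<in> elts x" "a \<notin> elts s" by blast
    with s show ?case by (intro exI[of _ "ins a s"]) (auto intro: equinumerous_succ)
  qed
  with that show ?thesis by blast
qed

section \<open>Standard cardinalities and the two choice principles\<close>

primrec num_of :: "nat \<Rightarrow> 'a" where
  "num_of 0 = emptyset"
| "num_of (Suc j) = succ (num_of j)"

text \<open>
  The number \<open>j\<close> is standard, so the cardinality in the structure and the one in HOL agree.
\<close>

definition has_card :: "nat \<Rightarrow> 'a \<Rightarrow> bool" where
  "has_card j z \<longleftrightarrow> finite (elts z) \<and> card (elts z) = j"

lemma is_numeral_iff: "is_numeral j n \<longleftrightarrow> n = num_of j"
  by (induction j arbitrary: n) (auto simp: is_empty_iff is_succ_iff)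

lemma is_nat_num_of: "is_nat (num_of j)"
  by (induction j) (auto intro: is_nat_emptyset is_nat_succ)

lemma has_card_num_of: "has_card j (num_of j)"
  by (induction j) (auto simp: has_card_def not_mem_self)

lemma equinumerous_num_of_iff: "equinumerous z (num_of j) \<longleftrightarrow> has_card j z"
proof
  assume "equinumerous z (num_of j)"
  then obtain h where "bij_betw h (elts z) (elts (num_of j))" by (auto simp: equinumerous_iff)
  then show "has_card j z"
    using has_card_num_of[of j] bij_betw_finite bij_betw_same_card by (metis has_card_def)
next
  show "has_card j z \<Longrightarrow> equinumerous z (num_of j)"
  proof (induction j arbitrary: z)
    case 0
    then show ?case by (auto simp: has_card_def equinumerous_emptyset_iff)
  next
    case (Suc j)
    then obtain a where a: "a \<in> elts z" by (fastforce simp: has_card_def)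
    then have "has_card j (rem z a)" using Suc.prems by (simp add: has_card_def)
    then have "equinumerous (ins a (rem z a)) (succ (num_of j))"
      using Suc.IH by (intro equinumerous_succ) auto
    then show ?case by (simp add: ins_rem a)
  qed
qed

lemma dfn_has_card [dfn_intros]: "dft t \<Longrightarrow> dfn (\<lambda>e. has_card j (t e))"
  unfolding equinumerous_num_of_iff[symmetric] by (intro dfn_intros)

lemma has_card_is_finite: "has_card j z \<Longrightarrow> is_finite z"
  unfolding is_finite_def using is_nat_num_of equinumerous_num_of_iff by blast

text \<open>The bound is standard although the size may not be. If the numeral of \<open>k\<close>
  is not an element of the size \<open>m\<close>, trichotomy gives
  \<open>m \<subseteq> num_of k\<close>, and then \<open>m\<close> is standard and at most
  \<open>k\<close>.\<close>

lemma finite_card_gt_iff: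
  "finite_card_gt (num_of k) z \<longleftrightarrow> is_finite z \<and> \<not> (\<exists>j\<le>k. has_card j z)"
proof
  assume "finite_card_gt (num_of k) z"
  then obtain m where m: "is_nat m" "num_of k \<in> elts m" "equinumerous z m"
    by (auto simp: finite_card_gt_def mem_iff_elts)
  have False if "j \<le> k" "has_card j z" for j
  proof -
    have "has_card j m"
      using that m(3) equinumerous_sym equinumerous_trans equinumerous_num_of_iff by blast
    moreover have "insert (num_of k) (elts (num_of k)) \<subseteq> elts m" using is_nat_transitive m by auto
    ultimately have "card (insert (num_of k) (elts (num_of k))) \<le> j"
      by (metis card_mono has_card_def)
    then show False using has_card_num_of[of k] not_mem_self[of "num_of k"] that(1) by (simp add: has_card_def)
  qed
  then show "is_finite z \<and> \<not> (\<exists>j\<le>k. has_card j z)" using m by (auto simp: is_finite_def)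
next
  assume *: "is_finite z \<and> \<not> (\<exists>j\<le>k. has_card j z)"
  then obtain m where m: "is_nat m" "equinumerous z m" by (auto simp: is_finite_def)
  have "elts m \<subseteq> elts (num_of k) \<Longrightarrow> False"
  proof -
    assume "elts m \<subseteq> elts (num_of k)"
    then have "finite (elts m)" "card (elts m) \<le> k"
      using has_card_num_of[of k] by (auto simp: has_card_def dest: finite_subset card_mono)
    then have "has_card (card (elts m)) m" by (simp add: has_card_def)
    then have "has_card (card (elts m)) z"
      using m(2) equinumerous_trans equinumerous_num_of_iff by blast
    with * \<open>card (elts m) \<le> k\<close> show False by blast
  qed
  then have "num_of k \<in> elts m"
    using is_nat_trichotomy[OF m(1) is_nat_num_of, of k] is_nat_transitive[OF is_nat_num_of, of m k] by auto
  with m show "finite_card_gt (num_of k) z" by (auto simp: finite_card_gt_def mem_iff_elts)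
qed

section \<open>The two principles and partial choice in terms of class functions\<close>

lemma nRC_finD:
  assumes "nRC_fin (num_of k)" "\<not> is_finite x"
  shows "\<exists>y f. elts y \<subseteq> elts x \<and> \<not> is_finite y \<and> dfun f \<and>
    (\<forall>z. elts z \<subseteq> elts y \<and> finite_card_gt (num_of k) z \<longrightarrow> elts (f z) \<subseteq> elts z \<and> has_card k (f z))"
proof -
  obtain y p q F where y: "elts y \<subseteq> elts x" "\<not> is_finite y"
    and p: "is_subsets_gt (num_of k) y p" and q: "is_subsets_eq (num_of k) y q"
    and F: "is_function F p q" and sub: "\<And>z v. z \<in> elts p \<Longrightarrow> maps_to F z v \<Longrightarrow> elts v \<subseteq> elts z"
    using assms unfolding nRC_fin_def subset_iff_elts by (metis mem_iff_elts)
  obtain f where f: "dfun f" "\<And>z. z \<in> elts p \<Longrightarrow> f z \<in> elts q"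
    "\<And>a b. maps_to F a b \<longleftrightarrow> a \<in> elts p \<and> b = f a"
    using dfun_of_function[OF F] by auto
  have "elts (f z) \<subseteq> elts z \<and> has_card k (f z)" if "elts z \<subseteq> elts y" "finite_card_gt (num_of k) z" for z
  proof -
    have "z \<in> elts p" using p that by (auto simp: is_subsets_gt_def mem_iff_elts subset_iff_elts)
    moreover from f(2)[OF this] have "has_card k (f z)"
      using q by (auto simp: is_subsets_eq_def mem_iff_elts equinumerous_num_of_iff)
    ultimately show ?thesis using sub f(3) by blast
  qed
  with y f(1) show ?thesis by (intro exI[of _ y] exI[of _ f]) auto
qed

text \<open>Partial choice for indexed families. Indices allow passing to smaller index sets and to
  other families, such as complements, before the family is finally indexed by itself.\<close>

definition chooses :: "nat \<Rightarrow> 'a \<Rightarrow> ('a \<Rightarrow> 'a) \<Rightarrow> bool" where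
  "chooses j I A \<longleftrightarrow> (\<exists>J g. elts J \<subseteq> elts I \<and> \<not> is_finite J \<and> dfun g \<and>
     (\<forall>i\<in>elts J. elts (g i) \<subseteq> elts (A i) \<and> has_card j (g i)))"

lemma choosesI:
  assumes "elts J \<subseteq> elts I" "\<not> is_finite J" "dfun g" "\<And>i. i \<in> elts J \<Longrightarrow> elts (g i) \<subseteq> elts (A i) \<and> has_card j (g i)"
  shows "chooses j I A"
  using assms unfolding chooses_def by (intro exI[of _ J] exI[of _ g]) auto

lemma chooses_elim:
  assumes "chooses j I A"
  obtains J g where "elts J \<subseteq> elts I" "\<not> is_finite J" "dfun g"
    "\<And>i. i \<in> elts J \<Longrightarrow> elts (g i) \<subseteq> elts (A i)" "\<And>i. i \<in> elts J \<Longrightarrow> has_card j (g i)"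
  using assms unfolding chooses_def by auto

lemma chooses_mono:
  assumes "chooses j J B" "elts J \<subseteq> elts I" "\<And>i. i \<in> elts J \<Longrightarrow> elts (B i) \<subseteq> elts (A i)"
  shows "chooses j I A"
proof -
  obtain K g where "elts K \<subseteq> elts J" "\<not> is_finite K" "dfun g"
    "\<And>i. i \<in> elts K \<Longrightarrow> elts (g i) \<subseteq> elts (B i)" "\<And>i. i \<in> elts K \<Longrightarrow> has_card j (g i)"
    by (rule chooses_elim[OF assms(1)]) blast
  with assms(2,3) show ?thesis by (intro choosesI[of K I g]) blast+
qed

lemma nC_fin_minusI:
  assumes "\<And>F. \<not> is_finite F \<Longrightarrow> \<forall>x\<in>elts F. finite_card_gt (num_of k) x \<Longrightarrow> chooses k F (\<lambda>x. x)"
  shows "nC_fin_minus (num_of k)"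
  unfolding nC_fin_minus_def
proof (intro allI impI, elim conjE)
  fix F assume F: "\<not> is_finite F" "\<forall>x. x \<^bold>\<in> F \<longrightarrow> finite_card_gt (num_of k) x"
  then have "chooses k F (\<lambda>x. x)" by (intro assms) (auto simp: mem_iff_elts)
  then obtain J g where J: "elts J \<subseteq> elts F" "\<not> is_finite J" and g: "dfun g"
    "\<And>i. i \<in> elts J \<Longrightarrow> elts (g i) \<subseteq> elts i" "\<And>i. i \<in> elts J \<Longrightarrow> has_card k (g i)"
    by (rule chooses_elim) blast
  let ?q = "sep (pow (big_cup J)) (\<lambda>z. equinumerous z (num_of k))"
  have q: "elts ?q = {z \<in> elts (pow (big_cup J)). equinumerous z (num_of k)}"
    by (rule elts_sep) (intro dfn_intros)
  have "elts (g i) \<subseteq> elts (big_cup J)" if "i \<in> elts J" for i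
    using g(2)[OF that] that by auto
  then have "g ` elts J \<subseteq> elts ?q"
    using g(3) unfolding q by (auto simp: equinumerous_num_of_iff simp del: elts_big_cup)
  from function_of_dfun[OF g(1) this] obtain f
    where f: "is_function f J ?q" "\<And>a b. maps_to f a b \<longleftrightarrow> a \<in> elts J \<and> b = g a" by blast
  show "\<exists>A. A \<^bold>\<subseteq> F \<and> \<not> is_finite A \<and> (\<exists>u q f. is_Union A u \<and> is_subsets_eq (num_of k) u q \<and>
    is_function f A q \<and> (\<forall>x v. x \<^bold>\<in> A \<longrightarrow> maps_to f x v \<longrightarrow> v \<^bold>\<subseteq> x))"
  proof (intro exI conjI)
    show "is_Union J (big_cup J)" by (auto simp: is_Union_def mem_iff_elts)
    show "is_subsets_eq (num_of k) (big_cup J) ?q" by (auto simp: is_subsets_eq_def mem_iff_elts q subset_iff_elts)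
    show "is_function f J ?q" by fact
    show "\<forall>x v. x \<^bold>\<in> J \<longrightarrow> maps_to f x v \<longrightarrow> v \<^bold>\<subseteq> x"
      using f(2) g(2) by (auto simp: subset_iff_elts)
  qed (use J in \<open>auto simp: subset_iff_elts\<close>)
qed

text \<open>
  \<open>B i\<close> is the trace of the infinite set given by \<open>nRC_fin\<close> on the copy \<open>{i} \<times> A i\<close> of \<open>A i\<close>, the indices
  in \<open>J\<close> are those with nonempty trace, and \<open>f\<close> selects \<open>k\<close>-subsets.
\<close>

definition selector ::
  "nat \<Rightarrow> 'a \<Rightarrow> ('a \<Rightarrow> 'a) \<Rightarrow> 'a \<Rightarrow> ('a \<Rightarrow> 'a) \<Rightarrow> ('a \<Rightarrow> 'a) \<Rightarrow> bool" where
  "selector k I A J B f \<longleftrightarrow> elts J \<subseteq> elts I \<and> \<not> is_finite J \<and> dfun B \<and> dfun f \<and>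
     (\<forall>i\<in>elts J. is_finite (B i) \<and> elts (B i) \<noteq> {} \<and> elts (B i) \<subseteq> opair i ` elts (A i)) \<and>
     (\<forall>z. elts z \<subseteq> (\<Union>i\<in>elts J. elts (B i)) \<and> finite_card_gt (num_of k) z \<longrightarrow> elts (f z) \<subseteq> elts z \<and> has_card k (f z))"

lemma selector_exists:
  assumes "nRC_fin (num_of k)" "\<not> is_finite I" and A: "dfun A"
    and fin: "\<And>i. i \<in> elts I \<Longrightarrow> is_finite (A i)" and ne: "\<And>i. i \<in> elts I \<Longrightarrow> elts (A i) \<noteq> {}"
  shows "\<exists>J B f. selector k I A J B f"
proof -
  let ?P = "\<lambda>i. repl (A i) (opair i)"
  have P: "dfun ?P" by (intro dfn_intros dft_app1[OF A])
  have opair: "dfun (opair i)" for i by (intro dfn_intros)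
  have elts_P: "elts (?P i) = opair i ` elts (A i)" for i by (rule elts_repl[OF opair])
  have proj1: "dfun proj1" by (intro dfn_intros)
  let ?x = "big_cup (repl I ?P)"
  have x: "elts ?x = (\<Union>i\<in>elts I. opair i ` elts (A i))" by (simp add: elts_repl[OF P] elts_P)
  \<comment> \<open>Since no \<open>A i\<close> is empty, the first projection maps the disjoint
    union onto \<open>I\<close>.\<close>
  have "\<not> is_finite ?x"
  proof
    assume "is_finite ?x"
    then have "is_finite (repl ?x proj1)" by (rule is_finite_repl[OF proj1])
    moreover have "elts I \<subseteq> elts (repl ?x proj1)"
    proof
      fix i assume i: "i \<in> elts I"
      then obtain a where "a \<in> elts (A i)" using ne by blast
      then have "proj1 (opair i a) \<in> proj1 ` elts ?x" unfolding x using i by blast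
      then show "i \<in> elts (repl ?x proj1)" by (simp add: elts_repl[OF proj1])
    qed
    ultimately show False using assms(2) is_finite_subset by blast
  qed
  from nRC_finD[OF assms(1) this] obtain y f where y: "elts y \<subseteq> elts ?x" "\<not> is_finite y"
    and f: "dfun f"
    "\<And>z. elts z \<subseteq> elts y \<and> finite_card_gt (num_of k) z \<longrightarrow> elts (f z) \<subseteq> elts z \<and> has_card k (f z)"
    by auto
  let ?B = "\<lambda>i. sep y (\<lambda>p. proj1 p = i)"
  have B: "dfun ?B" by (intro dfn_intros)
  have elts_B: "elts (?B i) = {p \<in> elts y. proj1 p = i}" for i by (rule elts_sep) (intro dfn_intros)
  let ?J = "sep I (\<lambda>i. \<exists>p\<in>elts y. proj1 p = i)"
  have J: "elts ?J = {i \<in> elts I. \<exists>p\<in>elts y. proj1 p = i}" by (rule elts_sep) (intro dfn_intros)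
  have sub: "elts (?B i) \<subseteq> opair i ` elts (A i)" for i
    using y(1) unfolding x elts_B by auto
  have fB: "is_finite (?B i)" if "i \<in> elts ?J" for i
  proof (rule is_finite_subset)
    show "is_finite (?P i)" using that by (intro is_finite_repl opair fin) (simp add: J)
    show "elts (?B i) \<subseteq> elts (?P i)" using sub by (simp add: elts_P)
  qed
  have "\<not> is_finite ?J"
  proof
    assume J': "is_finite ?J"
    \<comment> \<open>Finitely many nonempty traces would cover \<open>y\<close> by finitely many
      finite sets.\<close>
    have sub': "elts y \<subseteq> (\<Union>i\<in>elts ?J. elts (?B i))"
    proof
      fix p assume p: "p \<in> elts y"
      then obtain i a where "i \<in> elts I" "p = opair i a" using y(1) unfolding x by auto
      then have "i \<in> elts I" "proj1 p = i" by simp_all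
      with p have "i \<in> elts ?J" "p \<in> elts (?B i)" unfolding elts_B J by blast+
      then show "p \<in> (\<Union>i\<in>elts ?J. elts (?B i))" by blast
    qed
    have "is_finite y" by (rule is_finite_UN[of ?B, OF B J' _ sub']) (rule fB)
    with y(2) show False by simp
  qed
  moreover have "elts (?B i) \<noteq> {}" if "i \<in> elts ?J" for i using that by (auto simp: elts_B J)
  moreover have "(\<Union>i\<in>elts ?J. elts (?B i)) \<subseteq> elts y" unfolding elts_B by blast
  then have "\<forall>z. elts z \<subseteq> (\<Union>i\<in>elts ?J. elts (?B i)) \<and> finite_card_gt (num_of k) z \<longrightarrow> elts (f z) \<subseteq> elts z \<and> has_card k (f z)"
    using f(2) by blast
  moreover have "elts ?J \<subseteq> elts I" by (auto simp: J)
  ultimately have "selector k I A ?J ?B f"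
    unfolding selector_def using B f(1) sub fB by blast
  then show ?thesis by (intro exI)
qed

text \<open>The traces consist of pairs with first component \<open>i\<close>, so the second
  projection is injective on each and carries the choice back to \<open>A i\<close>.\<close>

lemma chooses_selector:
  assumes sel: "selector k I A J B f" and g: "dfun g" and K: "elts K \<subseteq> elts J" "\<not> is_finite K"
    and gB: "\<And>i. i \<in> elts K \<Longrightarrow> elts (g i) \<subseteq> elts (B i)" "\<And>i. i \<in> elts K \<Longrightarrow> has_card j (g i)"
  shows "chooses j I A"
proof (rule choosesI)
  have proj2: "dfun proj2" by (intro dfn_intros)
  show "dfun (\<lambda>i. repl (g i) proj2)" by (intro dfn_intros dft_app1[OF g])
  show "elts K \<subseteq> elts I" using sel K by (auto simp: selector_def)
  fix i assume i: "i \<in> elts K"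
  then have "elts (B i) \<subseteq> opair i ` elts (A i)"
    using sel K(1) by (simp add: selector_def subset_iff[of "elts K"])
  with gB(1)[OF i] have sub: "elts (g i) \<subseteq> opair i ` elts (A i)" by (rule subset_trans)
  have "inj_on proj2 (opair i ` elts (A i))" by (rule inj_onI) auto
  then have "inj_on proj2 (elts (g i))" using sub by (rule inj_on_subset)
  then show "elts (repl (g i) proj2) \<subseteq> elts (A i) \<and> has_card j (repl (g i) proj2)"
    using sub gB(2)[OF i] by (auto simp: elts_repl[OF proj2] has_card_def card_image)
qed (rule K)

text \<open>\<open>S\<close> is finite in HOL, so the induction runs outside the structure and each
  \<open>Q j\<close> only has to be definable by itself. Removing an internally finite piece keeps
  \<open>J\<close> infinite.\<close>

lemma infinite_split:
  assumes "finite S" "\<not> is_finite J" "\<And>i. i \<in> elts J \<Longrightarrow> \<exists>j\<in>S. Q j i" "\<And>j. dpred (Q j)"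
  shows "\<exists>j\<in>S. \<not> is_finite (sep J (Q j))"
  using assms(1-3)
proof (induction S arbitrary: J rule: finite_induct)
  case empty
  then have "elts J = {}" by blast
  then show ?case using empty is_finite_subset[OF is_finite_emptyset, of J] by simp
next
  case (insert j S)
  note Q = elts_sep[OF assms(4)]
  show ?case
  proof (cases "is_finite (sep J (Q j))")
    case True
    let ?J = "dif J (sep J (Q j))"
    have J: "elts ?J = {i \<in> elts J. \<not> Q j i}" by (auto simp: Q)
    have "elts J \<subseteq> elts (cup (sep J (Q j)) ?J)" by auto
    then have "\<not> is_finite ?J"
      using True insert.prems(1) is_finite_subset is_finite_cup by blast
    moreover have "\<exists>j'\<in>S. Q j' i" if "i \<in> elts ?J" for i
      using that insert.prems(2) unfolding J by blast
    ultimately have "\<exists>j'\<in>S. \<not> is_finite (sep ?J (Q j'))"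
      by (rule insert.IH)
    then obtain j' where "j' \<in> S" "\<not> is_finite (sep ?J (Q j'))" by blast
    moreover have "elts (sep ?J (Q j')) \<subseteq> elts (sep J (Q j'))" by (auto simp: Q)
    ultimately show ?thesis using is_finite_subset by blast
  qed blast
qed

text \<open>A trace with at most \<open>k\<close> elements is taken whole; a larger one is cut down
  to \<open>k\<close> elements by the selector. \<open>infinite_split\<close> then makes the size
  constant.\<close>

lemma chooses_some:
  assumes "nRC_fin (num_of k)" "\<not> is_finite I" "dfun A" "k \<ge> 1"
    and "\<And>i. i \<in> elts I \<Longrightarrow> is_finite (A i)" "\<And>i. i \<in> elts I \<Longrightarrow> elts (A i) \<noteq> {}"
  shows "\<exists>j\<in>{1..k}. chooses j I A"
proof -
  obtain J B f where sel: "selector k I A J B f"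
    using selector_exists[OF assms(1-3,5,6)] by auto
  then have J: "\<not> is_finite J" and B: "dfun B" and f: "dfun f"
    by (auto simp: selector_def)
  let ?g = "\<lambda>i. if finite_card_gt (num_of k) (B i) then f (B i) else B i"
  have g: "dfun ?g" by (intro dfn_intros dft_app1[OF B] dft_app1[OF f])
  have *: "elts (?g i) \<subseteq> elts (B i) \<and> (\<exists>j\<in>{1..k}. has_card j (?g i))" if "i \<in> elts J" for i
  proof (cases "finite_card_gt (num_of k) (B i)")
    case True
    moreover have "elts (B i) \<subseteq> (\<Union>i\<in>elts J. elts (B i))" using that by auto
    ultimately have "elts (f (B i)) \<subseteq> elts (B i) \<and> has_card k (f (B i))"
      using sel unfolding selector_def by blast
    with True \<open>k \<ge> 1\<close> show ?thesis by auto
  next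
    case False
    moreover have "is_finite (B i)" using sel that by (simp add: selector_def)
    ultimately obtain j where j: "j \<le> k" "has_card j (B i)"
      by (auto simp: finite_card_gt_iff)
    moreover have "elts (B i) \<noteq> {}" using sel that by (auto simp: selector_def)
    ultimately have "j \<ge> 1" by (cases j) (auto simp: has_card_def)
    with j False show ?thesis by auto
  qed
  have d: "dpred (\<lambda>i. has_card j (?g i))" for j
    by (intro dfn_intros dft_app1[OF B] dft_app1[OF f])
  have "\<exists>j\<in>{1..k}. \<not> is_finite (sep J (\<lambda>i. has_card j (?g i)))"
    by (rule infinite_split[OF _ J]) (use * d in auto)
  then obtain j where "j \<in> {1..k}" "\<not> is_finite (sep J (\<lambda>i. has_card j (?g i)))" by blast
  moreover have "elts (sep J (\<lambda>i. has_card j (?g i))) = {i \<in> elts J. has_card j (?g i)}" by (rule elts_sep[OF d])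
  ultimately show ?thesis
    using * by (intro bexI[of _ j] chooses_selector[OF sel g, of "sep J (\<lambda>i. has_card j (?g i))"]) auto
qed

section \<open>Families of pairs\<close>

text \<open>Otherwise every nonempty fibre would have exactly two elements, and
  \<open>card X\<close> would be even.\<close>

lemma odd_fibre:
  fixes h :: "'b \<Rightarrow> 'c"
  assumes "odd (card X)" "\<And>i. i \<in> h ` X \<Longrightarrow> card {p \<in> X. h p = i} \<le> 2"
  shows "\<exists>i\<in>h ` X. card {p \<in> X. h p = i} = 1"
proof (rule ccontr)
  assume no: "\<not> ?thesis"
  have fin: "finite X" using assms(1) by (cases "finite X") auto
  have "card {p \<in> X. h p = i} = 2" if "i \<in> h ` X" for i
  proof -
    have "{p \<in> X. h p = i} \<noteq> {}" using that by auto
    then have "card {p \<in> X. h p = i} \<noteq> 0" using fin by simp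
    with no assms(2)[OF that] that show ?thesis by (cases "card {p \<in> X. h p = i} = 1") auto
  qed
  then have "card X = (\<Sum>i\<in>h ` X. 2)"
    using sum.image_gen[OF fin, of "\<lambda>_. 1 :: nat" h] by simp
  with assms(1) show False by simp
qed

text \<open>Under the contrary assumption any definable choice of one point lives on a finite index
  set. This fact, \<open>finite_choice\<close>, yields every finiteness claim about in-degrees below
  and the final contradiction.\<close>

lemma chooses_pairs:
  assumes nRC: "nRC_fin (num_of 3)" and "\<not> is_finite I" and A: "dfun A"
    and pair: "\<And>i. i \<in> elts I \<Longrightarrow> has_card 2 (A i)"
  shows "chooses 1 I A"
proof (rule ccontr)
  assume no: "\<not> chooses 1 I A"
  have "\<exists>J B f. selector 3 I A J B f"
  proof (rule selector_exists[OF nRC assms(2) A])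
    fix i assume "i \<in> elts I"
    from pair[OF this] show "is_finite (A i)" "elts (A i) \<noteq> {}"
      by (auto intro: has_card_is_finite simp: has_card_def)
  qed
  then obtain J B f where sel: "selector 3 I A J B f" by blast
  then have J: "\<not> is_finite J" "elts J \<subseteq> elts I" and B: "dfun B" and f: "dfun f"
    and sub: "\<And>i. i \<in> elts J \<Longrightarrow> elts (B i) \<subseteq> opair i ` elts (A i)"
    and neB: "\<And>i. i \<in> elts J \<Longrightarrow> elts (B i) \<noteq> {}"
    by (auto simp: selector_def)
  have finite_choice: "is_finite K" if "dfun g" "elts K \<subseteq> elts J"
    "\<And>i. i \<in> elts K \<Longrightarrow> elts (g i) \<subseteq> elts (B i)" "\<And>i. i \<in> elts K \<Longrightarrow> has_card 1 (g i)" for K g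
    using chooses_selector[OF sel that(1,2) _ that(3,4)] no by blast
  have proj1: "proj1 p = i" if "i \<in> elts J" "p \<in> elts (B i)" for i p
    using sub[OF that(1)] that(2) by auto
  have B12: "has_card 1 (B i) \<or> has_card 2 (B i)" if i: "i \<in> elts J" for i
  proof -
    have A2: "finite (elts (A i))" "card (elts (A i)) = 2"
      using pair[of i] J(2) i by (auto simp: has_card_def)
    then have fin: "finite (elts (B i))" using sub[OF i] finite_subset by blast
    have "card (elts (B i)) \<le> card (opair i ` elts (A i))" using A2 sub[OF i] by (intro card_mono) auto
    also have "\<dots> \<le> 2" using A2 card_image_le[of "elts (A i)" "opair i"] by simp
    finally show ?thesis using fin neB[OF i] card_gt_0_iff[of "elts (B i)"]
      by (auto simp: has_card_def)
  qed
  let ?J1 = "sep J (\<lambda>i. has_card 1 (B i))" and ?J2 = "sep J (\<lambda>i. has_card 2 (B i))"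
  have J1: "elts ?J1 = {i \<in> elts J. has_card 1 (B i)}" by (rule elts_sep) (intro dfn_intros dft_app1[OF B])
  have elts_J2: "elts ?J2 = {i \<in> elts J. has_card 2 (B i)}" by (rule elts_sep) (intro dfn_intros dft_app1[OF B])
  have "is_finite ?J1" by (rule finite_choice[OF B]) (use J1 in blast)+
  moreover have "elts J \<subseteq> elts (cup ?J1 ?J2)" unfolding elts_cup J1 elts_J2 using B12 by blast
  ultimately have "\<not> is_finite ?J2" using J(1) is_finite_cup is_finite_subset by blast
  then obtain K where K: "\<not> is_finite K" "elts K \<subseteq> elts J" "\<And>i. i \<in> elts K \<Longrightarrow> has_card 2 (B i)"
    using elts_J2 by blast
  \<comment> \<open>\<open>c S i\<close> is the part inside \<open>B i\<close> of the 3-subset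
    selected from the union of the \<open>B j\<close> with \<open>j \<in> S\<close>.\<close>
  define c where "c S i = cap (f (big_cup (repl S B))) (B i)" for S i
  have c: "dft (\<lambda>e. c (s e) (t e))" if "dft s" "dft t" for s t
    unfolding c_def by (intro dfn_intros dft_app1[OF f] dft_app1[OF B] that)
  have c_sub: "elts (c S i) \<subseteq> elts (B i)" for S i by (simp add: c_def)
  \<comment> \<open>Two distinct indices make the union have at least four elements, so
    \<open>f\<close> applies to it; then \<open>odd_fibre\<close> is used for the three selected
    points.\<close>
  have odd_pick: "\<exists>i\<in>elts S. has_card 1 (c S i)"
    if S: "elts S \<subseteq> elts K" "is_finite S" "i \<in> elts S" "j \<in> elts S" "i \<noteq> j" for S i j
  proof -
    let ?z = "big_cup (repl S B)"
    have z: "elts ?z = (\<Union>i\<in>elts S. elts (B i))" by (simp add: elts_repl[OF B])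
    have "is_finite ?z"
      by (rule is_finite_UN[OF B S(2)]) (use K(3) S(1) has_card_is_finite z in auto)
    moreover have False if "m \<le> 3" "has_card m ?z" for m
    proof -
      have "elts (B i) \<inter> elts (B j) = {}" using proj1[of i] proj1[of j] S K(2) by blast
      moreover have "has_card 2 (B i)" "has_card 2 (B j)" using K(3) S by auto
      ultimately have "card (elts (B i) \<union> elts (B j)) = 4"
        by (simp add: has_card_def card_Un_disjoint)
      moreover have "elts (B i) \<union> elts (B j) \<subseteq> elts ?z" using S z by auto
      ultimately show False using that card_mono[of "elts ?z" "elts (B i) \<union> elts (B j)"]
        unfolding has_card_def by linarith
    qed
    ultimately have "finite_card_gt (num_of 3) ?z" unfolding finite_card_gt_iff by blast
    moreover have "elts ?z \<subseteq> (\<Union>i\<in>elts J. elts (B i))" unfolding z using S(1) K(2) by blast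
    ultimately have fz: "elts (f ?z) \<subseteq> elts ?z" "has_card 3 (f ?z)"
      using sel unfolding selector_def by blast+
    \<comment> \<open>Distinct traces have distinct first components, so the fibres of
      \<open>proj1\<close> on the 3-subset are its parts \<open>c S i\<close>.\<close>
    have fibre: "i \<in> elts S \<and> {p \<in> elts (f ?z). proj1 p = i} = elts (c S i)" if i: "i \<in> proj1 ` elts (f ?z)" for i
    proof -
      have in_B: "proj1 p \<in> elts S \<and> p \<in> elts (B (proj1 p))" if p: "p \<in> elts (f ?z)" for p
      proof -
        have "p \<in> elts ?z" using p fz(1) by blast
        then obtain i where "i \<in> elts S" "p \<in> elts (B i)" unfolding z by blast
        moreover from this have "proj1 p = i" using proj1 S(1) K(2) by blast
        ultimately show ?thesis by simp
      qed
      then have iS: "i \<in> elts S" using i by blast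
      moreover have "{p \<in> elts (f ?z). proj1 p = i} = elts (c S i)"
        using in_B proj1[of i] iS S(1) K(2) unfolding c_def elts_cap by blast
      ultimately show ?thesis by blast
    qed
    have c2: "finite (elts (c S i)) \<and> card (elts (c S i)) \<le> 2" if "i \<in> elts S" for i
    proof -
      have "has_card 2 (B i)" using K(3) S(1) that by blast
      then show ?thesis
        using c_sub[of S i] card_mono[of "elts (B i)" "elts (c S i)"] finite_subset
        unfolding has_card_def by metis
    qed
    have "\<exists>i\<in>proj1 ` elts (f ?z). card {p \<in> elts (f ?z). proj1 p = i} = 1"
    proof (rule odd_fibre)
      show "odd (card (elts (f ?z)))" using fz(2) by (simp add: has_card_def)
    qed (use fibre c2 in auto)
    then obtain i where "i \<in> proj1 ` elts (f ?z)" "card {p \<in> elts (f ?z). proj1 p = i} = 1" by blast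
    with fibre[of i] c2[of i] show ?thesis by (auto simp: has_card_def)
  qed
  have upair_commute: "upair i j = upair j i" for i j by (auto simp: upair_eq_iff)
  \<comment> \<open>Three points in two disjoint pairs split as 1 + 2. Since
    \<open>upair i j\<close> is unordered, this gives a tournament on \<open>K\<close>.\<close>
  have beat: "has_card 1 (c (upair i j) i) \<or> has_card 1 (c (upair i j) j)"
    if "i \<in> elts K" "j \<in> elts K" "i \<noteq> j" for i j
  proof -
    have "is_finite (upair i j)"
      by (rule is_finite_subset[of "ins i (ins j emptyset)"]) (auto intro: is_finite_ins is_finite_emptyset)
    then show ?thesis using odd_pick[of "upair i j" i j] that by auto
  qed
  \<comment> \<open>the in-neighbours of \<open>i\<close>, where \<open>j\<close> beats \<open>i\<close> if the 3-subset of \<open>B i \<union> B j\<close> meets \<open>B j\<close> in one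
    point\<close>
  define In where "In i = sep K (\<lambda>j. j \<noteq> i \<and> has_card 1 (c (upair i j) j))" for i
  have In_dft: "dft (\<lambda>e. In (s e))" if "dft s" for s
    by (rule dft_app1[OF _ that]) (unfold In_def, intro dfn_intros c)
  have elts_In: "elts (In i) = {j \<in> elts K. j \<noteq> i \<and> has_card 1 (c (upair i j) j)}" for i
    unfolding In_def by (rule elts_sep) (intro dfn_intros c)
  have fin_In: "is_finite (In i)" for i
  proof (rule finite_choice)
    show "dfun (\<lambda>j. c (upair i j) j)" by (intro dfn_intros c)
  qed (use c_sub K(2) elts_In in blast)+
  \<comment> \<open>the in-degree of \<open>i\<close>, a natural number of the structure\<close>
  define r where "r i = desc (\<lambda>k. is_nat k \<and> equinumerous (In i) k)" for i
  have r_dft: "dft (\<lambda>e. r (s e))" if "dft s" for s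
    by (rule dft_app1[OF _ that]) (unfold r_def, intro dfn_intros In_dft)
  have r: "is_nat (r i)" "equinumerous (In i) (r i)" for i
  proof -
    have "\<exists>!k. is_nat k \<and> equinumerous (In i) k"
      using fin_In[of i] is_nat_equinumerous_unique unfolding is_finite_def by blast
    from descI[OF this] show "is_nat (r i)" "equinumerous (In i) (r i)"
      unfolding r_def by blast+
  qed
  define D where "D i = sep K (\<lambda>j. r j = r i)" for i
  have D_dft: "dft (\<lambda>e. D (s e))" if "dft s" for s
    by (rule dft_app1[OF _ that]) (unfold D_def, intro dfn_intros r_dft)
  have elts_D: "elts (D i) = {j \<in> elts K. r j = r i}" for i
    unfolding D_def by (rule elts_sep) (intro dfn_intros r_dft)
  have fin_D: "is_finite (D i)" for i
  proof (rule ccontr)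
    assume inf: "\<not> is_finite (D i)"
    obtain S where S: "elts S \<subseteq> elts (D i)" "equinumerous S (succ (r i))"
      by (rule infinite_subset_of_size[OF is_nat_succ[OF r(1)[of i]] inf])
    then have finS: "is_finite S" using is_nat_succ[OF r(1)] unfolding is_finite_def by blast
    \<comment> \<open>\<open>?T\<close> consists of \<open>S\<close> and everything that beats a
      member of \<open>S\<close>, a finite set. A member \<open>b\<close> of \<open>D i\<close>
      outside it is beaten by all of \<open>S\<close>, so its in-degree would exceed
      \<open>r i\<close>.\<close>
    let ?T = "cup S (big_cup (repl S In))"
    have In': "dfun In" by (intro In_dft dfn_intros)
    have T: "elts ?T = elts S \<union> (\<Union>i\<in>elts S. elts (In i))" by (simp add: elts_repl[OF In'])
    have "is_finite (big_cup (repl S In))"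
      by (rule is_finite_UN[OF In' finS fin_In]) (simp add: elts_repl[OF In'])
    then have "is_finite ?T" by (rule is_finite_cup[OF finS])
    then have "\<not> elts (D i) \<subseteq> elts ?T" using inf is_finite_subset by blast
    then obtain b where b: "b \<in> elts (D i)" "b \<notin> elts S" "\<And>s. s \<in> elts S \<Longrightarrow> b \<notin> elts (In s)"
      unfolding T by blast
    have "elts S \<subseteq> elts (In b)"
    proof
      fix s assume s: "s \<in> elts S"
      then have "s \<in> elts K" "b \<in> elts K" "s \<noteq> b" using S(1) b by (auto simp: elts_D)
      then show "s \<in> elts (In b)"
        using beat[of s b] b(3)[OF s] upair_commute[of s b] by (auto simp: elts_In)
    qed
    moreover have "equinumerous (In b) (r i)" using b(1) r(2)[of b] by (simp add: elts_D)
    ultimately show False using is_nat_pigeonhole[OF r(1)[of i]] S(2) by blast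
  qed
  \<comment> \<open>\<open>?L\<close>: indices whose in-degree is not unique; \<open>?R\<close>: the others\<close>
  let ?L = "sep K (\<lambda>i. \<exists>j\<in>elts K. j \<noteq> i \<and> r j = r i)"
  have L: "elts ?L = {i \<in> elts K. \<exists>j\<in>elts K. j \<noteq> i \<and> r j = r i}"
    by (rule elts_sep) (intro dfn_intros r_dft)
  have "is_finite ?L"
  proof -
    \<comment> \<open>\<open>?M\<close> collects the indices singled out by the 3-subset of their
      own class, hence is finite. Every class in \<open>?L\<close> has at least two members and so
      meets \<open>?M\<close>; thus finitely many finite classes cover \<open>?L\<close>.\<close>
    let ?M = "sep ?L (\<lambda>i. has_card 1 (c (D i) i))"
    have M: "elts ?M = {i \<in> elts ?L. has_card 1 (c (D i) i)}"
      by (rule elts_sep) (intro dfn_intros c D_dft)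
    have "is_finite ?M"
    proof (rule finite_choice)
      show "dfun (\<lambda>i. c (D i) i)" by (intro dfn_intros c D_dft)
      show "elts ?M \<subseteq> elts J" unfolding M L using K(2) by blast
    qed (use c_sub M in blast)+
    moreover have "dfun D" by (intro D_dft dfn_intros)
    moreover have "elts ?L \<subseteq> (\<Union>i\<in>elts ?M. elts (D i))"
    proof
      fix i assume i: "i \<in> elts ?L"
      then obtain j where j: "j \<in> elts K" "j \<noteq> i" "r j = r i" unfolding L by blast
      have "i \<in> elts K" using i unfolding L by blast
      then have "\<exists>l\<in>elts (D i). has_card 1 (c (D i) l)"
        using odd_pick[OF _ fin_D[of i], of i j] j by (auto simp: elts_D)
      then obtain l where l: "l \<in> elts (D i)" "has_card 1 (c (D i) l)" by blast
      then have lK: "l \<in> elts K" "r l = r i" by (auto simp: elts_D)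
      then have "D l = D i" by (simp add: D_def)
      moreover have "l \<in> elts ?L" 
        unfolding L using lK j \<open>i \<in> elts K\<close> by (cases "l = i") auto
      ultimately have "l \<in> elts ?M" unfolding M using l by simp
      moreover have "i \<in> elts (D l)" using lK \<open>i \<in> elts K\<close> by (simp add: elts_D)
      ultimately show "i \<in> (\<Union>i\<in>elts ?M. elts (D i))" by blast
    qed
    ultimately show ?thesis using is_finite_UN[of D ?M ?L] fin_D by blast
  qed
  let ?R = "dif K ?L"
  have elts_R: "elts ?R = {i \<in> elts K. \<forall>j\<in>elts K. r j = r i \<longrightarrow> j = i}" unfolding elts_dif L by blast
  have infR: "\<not> is_finite ?R"
  proof
    assume "is_finite ?R"
    then have "is_finite (cup ?L ?R)" using \<open>is_finite ?L\<close> is_finite_cup by blast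
    moreover have "elts K \<subseteq> elts (cup ?L ?R)" by auto
    ultimately show False using K(1) is_finite_subset by blast
  qed
  let ?O = "\<lambda>i j. j \<in> elts ?R \<and> j \<noteq> i \<and> has_card 1 (c (upair i j) i)"
  \<comment> \<open>Among the indices in \<open>?R\<close> beaten by \<open>i\<close>,
    \<open>t i\<close> is the one of least in-degree. It is unique because \<open>r\<close> is
    injective on \<open>?R\<close>.\<close>
  define t where "t i = desc (\<lambda>j. ?O i j \<and> (\<forall>l. ?O i l \<longrightarrow> r l \<notin> elts (r j)))" for i
  have t_dft: "dft (\<lambda>e. t (s e))" if "dft s" for s
    by (rule dft_app1[OF _ that]) (unfold t_def, intro dfn_intros c r_dft)
  have t: "has_card 1 (c (upair i (t i)) i)" if i: "i \<in> elts ?R" for i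
  proof -
    let ?W = "sep ?R (\<lambda>j. j \<noteq> i \<and> has_card 1 (c (upair i j) i))"
    have W: "elts ?W = {j. ?O i j}"
      by (subst elts_sep) (intro dfn_intros c, blast)
    have rr: "dfun r" by (intro r_dft dfn_intros)
    \<comment> \<open>Only finitely many indices beat \<open>i\<close>, so \<open>i\<close> beats
      some member of the infinite \<open>?R\<close>.\<close>
    have "\<not> elts ?R \<subseteq> elts (ins i (In i))"
      using infR is_finite_ins[OF fin_In[of i]] is_finite_subset by blast
    then obtain j where j: "j \<in> elts ?R" "j \<noteq> i" "j \<notin> elts (In i)" by auto
    moreover have "i \<in> elts K" "j \<in> elts K" using i j by auto
    ultimately have "?O i j" using beat[of i j] by (auto simp: elts_In)
    then have "r j \<in> elts (repl ?W r)" unfolding elts_repl[OF rr] W by blast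
    \<comment> \<open>Foundation provides an \<in>-minimal in-degree; trichotomy of natural numbers
      makes it the least.\<close>
    then have "\<exists>y. y \<in> elts (repl ?W r) \<and> (\<forall>z. z \<in> elts (repl ?W r) \<longrightarrow> z \<notin> elts y)"
      by (intro foundation[simplified mem_iff_elts, THEN spec, THEN mp]) blast
    then obtain j where j: "?O i j" "\<And>l. ?O i l \<Longrightarrow> r l \<notin> elts (r j)"
      unfolding elts_repl[OF rr] W by blast
    have "t i = j"
      unfolding t_def
    proof (rule desc_eq)
      fix l assume l: "?O i l \<and> (\<forall>m. ?O i m \<longrightarrow> r m \<notin> elts (r l))"
      then have "r l = r j" using is_nat_trichotomy[OF r(1)[of l] r(1)[of j]] j by blast
      then show "l = j" using l j(1) unfolding elts_R by blast
    qed (use j in blast)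
    with j(1) show ?thesis by blast
  qed
  \<comment> \<open>Comparing \<open>i\<close> with \<open>t i\<close> picks one point of
    \<open>B i\<close> for every \<open>i\<close> in the infinite set \<open>?R\<close>.\<close>
  have "is_finite ?R"
  proof (rule finite_choice)
    show "dfun (\<lambda>i. c (upair i (t i)) i)" by (intro dfn_intros c t_dft)
    show "elts ?R \<subseteq> elts J" using K(2) by auto
  qed (use c_sub t in blast)+
  with infR show False by simp
qed

section \<open>Choosing one element at a time\<close>

text \<open>The only size between 1 and \<open>k\<close> to be ruled out is 2 for
  \<open>k = 3\<close>, and \<open>chooses_pairs\<close> turns those pairs into single
  points.\<close>

lemma chooses_one_or:
  assumes "k \<in> {2, 3}" and nRC: "nRC_fin (num_of k)" and "\<not> is_finite I" "dfun A"
    and "\<And>i. i \<in> elts I \<Longrightarrow> is_finite (A i)" "\<And>i. i \<in> elts I \<Longrightarrow> elts (A i) \<noteq> {}"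
  shows "chooses 1 I A \<or> chooses k I A"
proof -
  obtain j where j: "j \<in> {1..k}" "chooses j I A"
    using chooses_some[OF nRC assms(3,4) _ assms(5,6)] assms(1) by auto
  show ?thesis
  proof (cases "j = 2 \<and> k = 3")
    case True
    then have "chooses 2 I A" using j by simp
    then obtain J g where g: "elts J \<subseteq> elts I" "\<not> is_finite J" "dfun g"
      "\<And>i. i \<in> elts J \<Longrightarrow> elts (g i) \<subseteq> elts (A i)" "\<And>i. i \<in> elts J \<Longrightarrow> has_card 2 (g i)"
      by (rule chooses_elim) blast
    have "chooses 1 J g" using chooses_pairs[OF _ g(2,3,5)] nRC True by simp
    then have "chooses 1 I A" using g(1,4) by (rule chooses_mono)
    then show ?thesis by blast
  next
    case False
    then have "j = 1 \<or> j = k" using j assms(1) by auto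
    with j show ?thesis by blast
  qed
qed

text \<open>Each round adds one element from the complement of those already chosen, unless
  \<open>k\<close> elements come at once. The complement is nonempty as the sets have more than
  \<open>k\<close> elements.\<close>

lemma chooses_iterate:
  assumes k: "k \<in> {2, 3}" and nRC: "nRC_fin (num_of k)" and F: "\<not> is_finite F"
    and gt: "\<forall>x\<in>elts F. finite_card_gt (num_of k) x" and "m < k"
  shows "chooses (Suc m) F (\<lambda>x. x) \<or> chooses k F (\<lambda>x. x)"
  using \<open>m < k\<close>
proof (induction m)
  case 0
  have "elts x \<noteq> {}" if "x \<in> elts F" for x
    using gt that unfolding finite_card_gt_iff has_card_def by fastforce
  then show ?case
    using chooses_one_or[OF k nRC F dft_var] gt unfolding finite_card_gt_iff by simp
next
  case (Suc m)
  show ?case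
  proof (cases "chooses k F (\<lambda>x. x)")
    case False
    then have "chooses (Suc m) F (\<lambda>x. x)" using Suc by simp
    then obtain J g where g: "elts J \<subseteq> elts F" "\<not> is_finite J" "dfun g"
      "\<And>i. i \<in> elts J \<Longrightarrow> elts (g i) \<subseteq> elts i" "\<And>i. i \<in> elts J \<Longrightarrow> has_card (Suc m) (g i)"
      by (rule chooses_elim) blast
    let ?A = "\<lambda>i. dif i (g i)"
    have A: "dfun ?A" by (intro dfn_intros dft_app1[OF g(3)])
    have "chooses 1 J ?A \<or> chooses k J ?A"
    proof (rule chooses_one_or[OF k nRC g(2) A])
      fix i assume i: "i \<in> elts J"
      then have *: "is_finite i" "\<not> (\<exists>j\<le>k. has_card j i)"
        using gt g(1) unfolding finite_card_gt_iff by blast+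
      show "is_finite (?A i)" by (rule is_finite_subset[OF *(1)]) auto
      show "elts (?A i) \<noteq> {}"
      proof
        assume "elts (?A i) = {}"
        then have "elts i = elts (g i)" using g(4)[OF i] by auto
        then have "has_card (Suc m) i" using g(5)[OF i] by (simp add: has_card_def)
        with *(2) Suc.prems show False by auto
      qed
    qed
    then show ?thesis
    proof
      assume "chooses k J ?A"
      then show ?thesis using chooses_mono[OF _ g(1), of k ?A "\<lambda>x. x"] by auto
    next
      assume "chooses 1 J ?A"
      then obtain L h where h: "elts L \<subseteq> elts J" "\<not> is_finite L" "dfun h"
        "\<And>i. i \<in> elts L \<Longrightarrow> elts (h i) \<subseteq> elts (?A i)" "\<And>i. i \<in> elts L \<Longrightarrow> has_card 1 (h i)"
        by (rule chooses_elim) blast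
      have "chooses (Suc (Suc m)) F (\<lambda>x. x)"
      proof (rule choosesI[OF _ h(2)])
        show "dfun (\<lambda>i. cup (g i) (h i))"
          by (intro dfn_intros dft_app1[OF g(3)] dft_app1[OF h(3)])
        show "elts L \<subseteq> elts F" using h(1) g(1) by blast
        fix i assume i: "i \<in> elts L"
        then have iJ: "i \<in> elts J" using h(1) by blast
        have "elts (h i) \<subseteq> elts i - elts (g i)" using h(4)[OF i] by simp
        moreover from this have "elts (g i) \<inter> elts (h i) = {}" by blast
        ultimately show "elts (cup (g i) (h i)) \<subseteq> elts i \<and> has_card (Suc (Suc m)) (cup (g i) (h i))"
          using g(4,5)[OF iJ] h(5)[OF i] by (auto simp: has_card_def card_Un_disjoint)
      qed
      then show ?thesis by blast
    qed
  qed blast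
qed

end

theorem lemma6p1:
  fixes mem :: "'a \<Rightarrow> 'a \<Rightarrow> bool" and k :: nat and n :: 'a
  assumes "ZF mem"
    and "k \<in> {2, 3}"
    and "set_structure.is_numeral mem k n"
    and "set_structure.nRC_fin mem n"
  shows "set_structure.nC_fin_minus mem n"
proof -
  interpret ZF mem by fact
  have n: "n = num_of k" using assms(3) by (simp add: is_numeral_iff)
  \<comment> \<open>For \<open>m = k - 1\<close> both alternatives of \<open>chooses_iterate\<close>
    say the same.\<close>
  have k: "k - 1 < k" "Suc (k - 1) = k" using assms(2) by auto
  show ?thesis
    using chooses_iterate[OF assms(2) assms(4)[unfolded n] _ _ k(1)] k(2) unfolding n
    by (intro nC_fin_minusI) auto
qed

end
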